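(* Fix $\alpha\in(0,1)$ and write $K(X,\mathcal{M})$ for $K(X,\mathcal{M},\alpha,\infty)$. Let $(s_p)$ and $(\delta_p)$ be sequences such that $s_p$ is an integer with $1\le s_p<p$, $\delta_p>0$, $\delta_p\to0$ as $p\to\infty$, and $$\lim_{p\to\infty}\delta_p\sqrt{s_p}\sqrt{1-\log s_p/\log p+1/\log p}=+\infty .$$ Then there exist constants $A,B>0$ not depending on $p$ such that, for all sufficiently large $p$: (i) $$\sup_{\substack{n\in\mathbb{N},\ 1\le s\le s_p,\ X\in\mathbb{R}^{n\times p}\\ \text{s.t. }\delta(X,s)\le\delta_p}}K(X,\mathcal{M}_s)\;\le\;B\,\delta_p\sqrt{s_p}\sqrt{\log(6p/s_p)};$$ (ii) there exists a design matrix $X_p$ with $p$ columns such that $\delta(X_p,s_p)\le\delta_p$ and $$K(X_p,\mathcal{M}_{s_p})\;\ge\;A\,\delta_p\sqrt{s_p}\sqrt{\log\left(\min\left(1/\delta_p^2,\ \lfloor (p-1)/s_p\rfloor\right)\right)} .$$ In particular, if $\delta_p=O(p^{-\lambda})$ for some $\lambda>0$ and if $\lfloor (p-1)/s_p\rfloor\ge2$ (for all large $p$), then the upper bound in (i) and the lower bound in (ii) have the same rate, i.e. the ratio of the right-hand side of (i) to the right-hand side of (ii) is bounded above and bounded away from zero as $p\to\infty$.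
   Context: For a real $n\times p$ matrix $X$ and $M\subset\{1,\ldots,p\}$, $X_M$ is the submatrix of the columns of $X$ with indices in $M$; $^t$ denotes transpose. For a symmetric nonnegative matrix $A$, $\mathrm{corr}(A)=(\mathrm{diag}(A)^\dagger)^{1/2}A(\mathrm{diag}(A)^\dagger)^{1/2}$, where $\mathrm{diag}(A)$ is obtained from $A$ by setting all off-diagonal entries to zero and $B^\dagger$ is the Moore-Penrose pseudo-inverse of $B$. Define $$\delta(X,s)=\sup_{M\subset\{1,\ldots,p\},\,1\le|M|\le s}\left\|\mathrm{corr}(X_M^tX_M)-I_{|M|}\right\|_{op},$$ with $\|\cdot\|_{op}$ the Euclidean operator norm. Let $\mathcal{M}_s$ be the set of non-empty $M\subset\{1,\ldots,p\}$ with $|M|\le s$. (When $\delta(X,s)<1$, every $X_M$ with $M\in\mathcal{M}_s$ has full column rank.) For $M\in\mathcal{M}_s$ and $i\in M$, let $i.M\in\{1,\ldots,|M|\}$ be the rank of $i$ among the elements of $M$ in increasing order, let $e_a^b$ be the $a$-th standard basis column vector of $\mathbb{R}^b$, and set $$v_{M,i}^t=(e_{i.M}^{|M|})^t(X_M^tX_M)^{-1}X_M^t,\qquad w_{M,i}=v_{M,i}/\|v_{M,i}\| \ (\text{and } w_{M,i}=0 \text{ if } v_{M,i}=0).$$ With $\xi$ a standard Gaussian vector in $\mathbb{R}^n$, the PoSI constant $K(X,\mathcal{M}_s,\alpha,\infty)$ is the $(1-\alpha)$-quantile of $\max_{M\in\mathcal{M}_s,\,i\in M}|w_{M,i}^t\xi|$.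 The constants $A$ and $B$ may depend on $\alpha$ and on the sequences. *)

theory Defs
  imports
    "HOL-Probability.Probability"
    "HOL-Library.Landau_Symbols"
    "Jordan_Normal_Form.Matrix"
    "Jordan_Normal_Form.Gauss_Jordan_Elimination"
    "Jordan_Normal_Form.DL_Submatrix"
begin

text \<open>
  An \<open>n \<times> p\<close> design matrix is an element of \<^term>\<open>carrier_mat n p :: real mat set\<close>.
  Columns are numbered from \<open>0\<close>, so that a model is a set \<open>M \<subseteq> {..<p}\<close>.
\<close>

definition vnorm :: "real Matrix.vec \<Rightarrow> real" where
  "vnorm v = sqrt (scalar_prod v v)"

definition op_norm :: "real Matrix.mat \<Rightarrow> real" where
  "op_norm A = (SUP v \<in> {v \<in> carrier_vec (dim_col A). vnorm v \<le> 1}. vnorm (A *\<^sub>v v))"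

definition is_pinv :: "real Matrix.mat \<Rightarrow> real Matrix.mat \<Rightarrow> bool" where
  "is_pinv A B \<longleftrightarrow> B \<in> carrier_mat (dim_col A) (dim_row A) \<and>
     A * B * A = A \<and> B * A * B = B \<and>
     transpose_mat (A * B) = A * B \<and> transpose_mat (B * A) = B * A"

definition pinv :: "real Matrix.mat \<Rightarrow> real Matrix.mat" where
  "pinv A = (THE B. is_pinv A B)"

definition psd_mat :: "real Matrix.mat \<Rightarrow> bool" where
  "psd_mat A \<longleftrightarrow> A \<in> carrier_mat (dim_row A) (dim_row A) \<and> transpose_mat A = A \<and>
     (\<forall>v \<in> carrier_vec (dim_row A). 0 \<le> scalar_prod v (A *\<^sub>v v))"

text \<open>The unique positive semidefinite square root; only meaningful if \<^term>\<open>psd_mat A\<close>.\<close>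

definition psd_sqrt :: "real Matrix.mat \<Rightarrow> real Matrix.mat" where
  "psd_sqrt A = (THE B. psd_mat B \<and> B * B = A)"

definition diag_part :: "real Matrix.mat \<Rightarrow> real Matrix.mat" where
  "diag_part A = mat_diag (dim_row A) (\<lambda>i. A $$ (i, i))"

definition corr :: "real Matrix.mat \<Rightarrow> real Matrix.mat" where
  "corr A = psd_sqrt (pinv (diag_part A)) * A * psd_sqrt (pinv (diag_part A))"

definition sub_cols :: "real Matrix.mat \<Rightarrow> nat set \<Rightarrow> real Matrix.mat" where
  "sub_cols X M = submatrix X UNIV M"

definition gram :: "real Matrix.mat \<Rightarrow> nat set \<Rightarrow> real Matrix.mat" where
  "gram X M = transpose_mat (sub_cols X M) * sub_cols X M"

definition models :: "nat \<Rightarrow> nat \<Rightarrow> nat set set" where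
  "models p s = {M. M \<subseteq> {..<p} \<and> M \<noteq> {} \<and> card M \<le> s}"

definition rip_delta :: "real Matrix.mat \<Rightarrow> nat \<Rightarrow> real" where
  "rip_delta X s =
     (SUP M \<in> models (dim_col X) s. op_norm (corr (gram X M) - 1\<^sub>m (card M)))"

text \<open>
  The rank of \<open>i\<close> among the elements of \<open>M\<close> in increasing order, counted from \<open>0\<close>
  to agree with the indexing of vectors.
\<close>

definition rank_in :: "nat \<Rightarrow> nat set \<Rightarrow> nat" where
  "rank_in i M = card {j \<in> M. j < i}"

text \<open>
  \<open>v\<^sup>t = e\<^sup>t (X\<^sub>M\<^sup>t X\<^sub>M)\<inverse> X\<^sub>M\<^sup>t\<close>, written as a column vector. It is only meaningful if
  \<open>X\<^sub>M\<close> has full column rank: otherwise \<^term>\<open>mat_inverse (gram X M) = None\<close> and the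
  value is unspecified.
\<close>

definition posi_v :: "real Matrix.mat \<Rightarrow> nat set \<Rightarrow> nat \<Rightarrow> real Matrix.vec" where
  "posi_v X M i =
     transpose_mat (the (mat_inverse (gram X M)) * transpose_mat (sub_cols X M))
       *\<^sub>v unit_vec (card M) (rank_in i M)"

definition posi_w :: "real Matrix.mat \<Rightarrow> nat set \<Rightarrow> nat \<Rightarrow> real Matrix.vec" where
  "posi_w X M i =
     (if posi_v X M i = 0\<^sub>v (dim_row X) then 0\<^sub>v (dim_row X)
      else (1 / vnorm (posi_v X M i)) \<cdot>\<^sub>v posi_v X M i)"

definition quantile :: "'a measure \<Rightarrow> ('a \<Rightarrow> real) \<Rightarrow> real \<Rightarrow> real" where
  "quantile P Y q = Inf {t. q \<le> measure P {x \<in> space P. Y x \<le> t}}"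

text \<open>
  The law of a standard Gaussian vector in \<open>\<real>\<^sup>n\<close>, whose coordinates are functions on
  \<open>{..<n}\<close>; \<^term>\<open>Matrix.vec n \<xi>\<close> is the corresponding vector.
\<close>

definition std_gaussian :: "nat \<Rightarrow> (nat \<Rightarrow> real) measure" where
  "std_gaussian n = (\<Pi>\<^sub>M i \<in> {..<n}. density lborel std_normal_density)"

text \<open>
  The PoSI constant for infinitely many degrees of freedom (known noise level).
\<close>

definition posi_const :: "real Matrix.mat \<Rightarrow> nat set set \<Rightarrow> real \<Rightarrow> real" where
  "posi_const X \<M> \<alpha> =
     quantile (std_gaussian (dim_row X))
       (\<lambda>\<xi>. Max {\<bar>scalar_prod (posi_w X M i) (Matrix.vec (dim_row X) \<xi>)\<bar> | M i. M \<in> \<M> \<and> i \<in> M})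
       (1 - \<alpha>)"

definition upper_rate :: "(nat \<Rightarrow> nat) \<Rightarrow> (nat \<Rightarrow> real) \<Rightarrow> real \<Rightarrow> nat \<Rightarrow> real" where
  "upper_rate s \<delta> B p =
     B * \<delta> p * sqrt (real (s p)) * sqrt (ln (6 * real p / real (s p)))"

definition lower_rate :: "(nat \<Rightarrow> nat) \<Rightarrow> (nat \<Rightarrow> real) \<Rightarrow> real \<Rightarrow> nat \<Rightarrow> real" where
  "lower_rate s \<delta> A p =
     A * \<delta> p * sqrt (real (s p)) *
       sqrt (ln (min (1 / (\<delta> p)\<^sup>2) (real_of_int \<lfloor>(real p - 1) / real (s p)\<rfloor>)))"

end

theory Submission
  imports Defs "Jordan_Normal_Form.Determinant"
begin

text \<open>
  Fix \<open>M\<close> and \<open>i \<in> M\<close>. The vector \<open>v\<close> lies in the span of the columns of \<open>X\<^sub>M\<close> and is orthogonal to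
  all of them but the \<open>i\<close>-th, so it is proportional to the residual of the \<open>i\<close>-th column on the others.

  Upper bound: under the restricted isometry property all residuals are within \<open>2 \<delta>\<close> of a multiple
  (of modulus at most \<open>1\<close>) of the normalized \<open>i\<close>-th column. Hence the maximum splits into a maximum of
  \<open>p\<close> standard Gaussians, of order \<open>sqrt (ln p)\<close>, and a maximum of at most \<open>s (e p / s)\<^sup>s\<close> Gaussians with
  standard deviation at most \<open>2 \<delta>\<close>. The rate assumption says that the second term dominates.

  Lower bound: take \<open>p - 1\<close> orthonormal columns and a unit vector having inner product \<open>a = \<delta> / sqrt s\<close>
  with \<open>k\<close> of them, where \<open>k = \<lfloor>s m\<rfloor>\<close> and \<open>m\<close> is the minimum in the claimed bound. Removing the coordinates
  in \<open>M\<close> from the last column changes its product with \<open>\<xi>\<close> by \<open>a\<close> times the sum of \<open>\<xi>\<close> over \<open>M\<close>.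
  A constant times \<open>s\<close> of the \<open>k\<close> coordinates exceed \<open>sqrt (ln m)\<close> with high probability, and \<open>M\<close> may
  consist of these.
\<close>

subsection \<open>Pseudo-inverse and square root of diagonal matrices\<close>

text \<open>Penrose's argument: \<open>A * B\<close> and \<open>A * C\<close> are symmetric and each
  absorbs the other, so they coincide, and likewise \<open>B * A\<close> and \<open>C * A\<close>;
  then \<open>B = B A B = B A C = C A C = C\<close>. Uniqueness gives the definite description in
  \<open>pinv\<close> its value.\<close>

lemma is_pinv_unique:
  assumes B: "is_pinv A B" and C: "is_pinv A C"
  shows "B = C"
proof -
  define m n where "m = dim_row A" and "n = dim_col A"
  have cA: "A \<in> carrier_mat m n" by (simp add: m_def n_def)
  have cB: "B \<in> carrier_mat n m" and cC: "C \<in> carrier_mat n m"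
    using assms by (auto simp: is_pinv_def m_def n_def)
  note as = assoc_mult_mat
  have AB: "A * B = A * C"
  proof -
    have "A * B = (A * C * A) * B" using C by (simp add: is_pinv_def)
    also have "\<dots> = (A * C) * (A * B)" using cA cB cC by (meson as mult_carrier_mat)
    also have "\<dots> = transpose_mat (A * C) * transpose_mat (A * B)"
      using B C by (simp add: is_pinv_def)
    also have "\<dots> = transpose_mat ((A * B) * (A * C))"
      using cA cB cC by (metis mult_carrier_mat transpose_mult)
    also have "(A * B) * (A * C) = (A * B * A) * C" using cA cB cC by (metis as mult_carrier_mat)
    also have "\<dots> = A * C" using B by (simp add: is_pinv_def)
    also have "transpose_mat \<dots> = A * C" using C by (simp add: is_pinv_def)
    finally show ?thesis .
  qed
  have BA: "B * A = C * A"
  proof -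
    have "B * A = B * (A * C * A)" using C by (simp add: is_pinv_def)
    also have "\<dots> = (B * A) * (C * A)" using cA cB cC by (metis as mult_carrier_mat)
    also have "\<dots> = transpose_mat (B * A) * transpose_mat (C * A)"
      using B C by (simp add: is_pinv_def)
    also have "\<dots> = transpose_mat ((C * A) * (B * A))"
      using cA cB cC by (metis mult_carrier_mat transpose_mult)
    also have "(C * A) * (B * A) = C * (A * B * A)" using cA cB cC by (metis as mult_carrier_mat)
    also have "\<dots> = C * A" using B by (simp add: is_pinv_def)
    also have "transpose_mat \<dots> = C * A" using C by (simp add: is_pinv_def)
    finally show ?thesis .
  qed
  have "B = B * A * B" using B by (simp add: is_pinv_def)
  also have "\<dots> = B * (A * C)" using cA cB cC AB by (metis as)
  also have "\<dots> = C * A * C" using cA cB cC BA by (metis as)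
  also have "\<dots> = C" using C by (simp add: is_pinv_def)
  finally show ?thesis .
qed

lemma mat_diag_cong: "(\<And>i. i < n \<Longrightarrow> f i = g i) \<Longrightarrow> mat_diag n f = mat_diag n g"
  by (auto simp: mat_diag_def)

lemma transpose_mat_diag: "transpose_mat (mat_diag n f) = mat_diag n f"
  by (auto simp: mat_diag_def)

text \<open>Since \<open>inverse 0 = 0\<close>, zero diagonal entries are inverted to zero, exactly
  as the Moore-Penrose equations demand.\<close>

lemma pinv_mat_diag: "pinv (mat_diag n f) = mat_diag n (\<lambda>i. inverse (f i))"
  unfolding pinv_def
proof (rule the_equality)
  show "is_pinv (mat_diag n f) (mat_diag n (\<lambda>i. inverse (f i)))"
    unfolding is_pinv_def
    by (auto simp: transpose_mat_diag carrier_matD[OF mat_diag_dim] intro!: mat_diag_cong)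
       (metis right_inverse left_inverse)+
  then show "B = mat_diag n (\<lambda>i. inverse (f i))" if "is_pinv (mat_diag n f) B" for B
    using that is_pinv_unique by blast
qed

lemma scalar_prod_mult_mat_vec:
  assumes "A \<in> carrier_mat m n" "u \<in> carrier_vec m" "v \<in> carrier_vec n"
  shows "scalar_prod u (A *\<^sub>v v) = (\<Sum>i<m. \<Sum>j<n. vec_index u i * A $$ (i, j) * vec_index v j)"
  using assms by (simp add: scalar_prod_def sum_distrib_left atLeast0LessThan mult.assoc)

text \<open>Let \<open>D\<close> be the diagonal matrix of the \<open>sqrt (f i)\<close>.
  \<open>B\<close> commutes with \<open>B * B\<close>, hence with \<open>D\<close>, so
  \<open>(B + D) * (B - D) = 0\<close>. For a column \<open>y\<close> of \<open>B - D\<close> this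
  reads \<open>B y = - D y\<close>; positivity of \<open>B\<close> and \<open>D\<close> forces both
  sides to vanish, and then \<open>y\<close> vanishes as well.\<close>

lemma psd_sqrt_unique_diag:
  assumes psd: "psd_mat B" and sq: "B * B = mat_diag n f" and f: "\<And>i. i < n \<Longrightarrow> 0 \<le> f i"
  shows "B = mat_diag n (\<lambda>i. sqrt (f i))"
proof -
  have cB: "B \<in> carrier_mat n n"
    using psd arg_cong[OF sq, of dim_row] by (simp add: psd_mat_def mat_diag_def)
  define b r where "b i j = B $$ (i, j)" and "r i = sqrt (f i)" for i j
  have sym: "b i j = b j i" if "i < n" "j < n" for i j
  proof -
    have "B $$ (i, j) = transpose_mat B $$ (i, j)" using psd by (simp add: psd_mat_def)
    also have "\<dots> = B $$ (j, i)" using cB that by simp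
    finally show ?thesis by (simp add: b_def)
  qed
  have rr: "r i * r i = f i" if "i < n" for i using f[OF that] by (simp add: r_def)
  have bb: "(\<Sum>k<n. b i k * b k j) = (if i = j then f j else 0)" if "i < n" "j < n" for i j
    using arg_cong[OF sq, of "\<lambda>A. A $$ (i, j)"] that cB
    by (simp add: b_def mat_diag_def scalar_prod_def atLeast0LessThan)
  have "B * mat_diag n f = mat_diag n f * B"
    unfolding sq[symmetric] using cB by (simp add: assoc_mult_mat)
  then have "b i j * f j = f i * b i j" if "i < n" "j < n" for i j
    using arg_cong[of _ _ "\<lambda>A. A $$ (i, j)"] that cB
    by (fastforce simp: b_def mat_diag_mult_left[OF cB] mat_diag_mult_right[OF cB])
  \<comment> \<open>A non-zero entry \<open>b i j\<close> forces \<open>f i = f j\<close>, hence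
    equal roots.\<close>
  then have comm: "b i j * r j = r i * b i j" if "i < n" "j < n" for i j
    using that by (cases "b i j = 0") (auto simp: r_def)
  have "b i c = (if i = c then r c else 0)" if c: "c < n" and i: "i < n" for i c
  proof -
    define y where "y i = b i c - (if i = c then r c else 0)" for i
    have By: "(\<Sum>k<n. b i k * y k) = - (r i * y i)" if i: "i < n" for i
    proof -
      have "(\<Sum>k<n. b i k * y k) = (\<Sum>k<n. b i k * b k c) - (\<Sum>k<n. if k = c then b i k * r c else 0)"
        unfolding sum_subtractf[symmetric] by (intro sum.cong refl) (simp add: y_def algebra_simps)
      also have "\<dots> = (if i = c then f c else 0) - b i c * r c"
        using c i bb by simp
      also have "\<dots> = - (r i * y i)" using comm[OF i c] rr[OF c] by (auto simp: y_def algebra_simps)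
      finally show ?thesis .
    qed
    have "0 \<le> scalar_prod (Matrix.vec n y) (B *\<^sub>v Matrix.vec n y)"
      using psd cB by (simp add: psd_mat_def)
    also have "\<dots> = (\<Sum>i<n. y i * (\<Sum>k<n. b i k * y k))"
      by (subst scalar_prod_mult_mat_vec[OF cB])
         (auto simp: b_def sum_distrib_left mult.assoc intro!: sum.cong)
    also have "\<dots> = - (\<Sum>i<n. r i * (y i)\<^sup>2)"
      by (simp add: By sum_negf power2_eq_square mult.left_commute)
    finally have "(\<Sum>i<n. r i * (y i)\<^sup>2) \<le> 0" by simp
    moreover have nn: "0 \<le> r i * (y i)\<^sup>2" if "i < n" for i using f[OF that] by (simp add: r_def)
    ultimately have "(\<Sum>i<n. r i * (y i)\<^sup>2) = 0" by (intro antisym sum_nonneg) auto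
    then have "\<forall>i\<in>{..<n}. r i * (y i)\<^sup>2 = 0" using nn by (subst (asm) sum_nonneg_eq_0_iff) auto
    then have ry: "r i * y i = 0" if "i < n" for i using that by auto
    \<comment> \<open>By symmetry of \<open>B\<close>, the squared norm of \<open>y\<close> is entry
      \<open>c\<close> of \<open>B y\<close> minus entry \<open>c\<close> of
      \<open>D y\<close>.\<close>
    have "(\<Sum>i<n. (y i)\<^sup>2) = (\<Sum>i<n. b c i * y i) - (\<Sum>i<n. if i = c then r c * y c else 0)"
      unfolding sum_subtractf[symmetric]
      using sym c by (intro sum.cong) (auto simp: y_def power2_eq_square algebra_simps)
    also have "\<dots> = 0" using By[OF c] ry[OF c] c by simp
    finally have "\<forall>i\<in>{..<n}. (y i)\<^sup>2 = 0" by (subst (asm) sum_nonneg_eq_0_iff) auto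
    then have "y i = 0" using i by auto
    then show ?thesis by (simp add: y_def)
  qed
  then show ?thesis using cB by (intro eq_matI) (auto simp: b_def r_def mat_diag_def)
qed

lemma psd_mat_mat_diag:
  assumes "\<And>i. i < n \<Longrightarrow> 0 \<le> f i"
  shows "psd_mat (mat_diag n f)"
proof -
  have "0 \<le> scalar_prod v (mat_diag n f *\<^sub>v v)" if "v \<in> carrier_vec n" for v
  proof -
    have "scalar_prod v (mat_diag n f *\<^sub>v v) = (\<Sum>i<n. \<Sum>j<n. if i = j then f j * (vec_index v j)\<^sup>2 else 0)"
      unfolding scalar_prod_mult_mat_vec[OF mat_diag_dim that that]
      by (intro sum.cong refl) (simp add: mat_diag_def power2_eq_square)
    also have "\<dots> \<ge> 0" using assms by (intro sum_nonneg) auto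
    finally show ?thesis .
  qed
  then show ?thesis by (simp add: psd_mat_def transpose_mat_diag carrier_matD[OF mat_diag_dim])
qed

lemma psd_sqrt_mat_diag:
  assumes "\<And>i. i < n \<Longrightarrow> 0 \<le> f i"
  shows "psd_sqrt (mat_diag n f) = mat_diag n (\<lambda>i. sqrt (f i))"
  unfolding psd_sqrt_def
proof (rule the_equality)
  show "psd_mat (mat_diag n (\<lambda>i. sqrt (f i))) \<and>
      mat_diag n (\<lambda>i. sqrt (f i)) * mat_diag n (\<lambda>i. sqrt (f i)) = mat_diag n f"
    using assms by (auto intro!: psd_mat_mat_diag mat_diag_cong)
qed (use assms psd_sqrt_unique_diag in blast)

text \<open>Division by zero yields zero, in agreement with the pseudo-inverse, so that zero columns
  of a design need no separate treatment.\<close>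

lemma corr_eq:
  assumes A: "A \<in> carrier_mat n n" and d: "\<And>i. i < n \<Longrightarrow> 0 \<le> A $$ (i, i)"
  shows "corr A = Matrix.mat n n (\<lambda>(i, j). A $$ (i, j) / (sqrt (A $$ (i, i)) * sqrt (A $$ (j, j))))"
proof -
  have "psd_sqrt (pinv (diag_part A)) = mat_diag n (\<lambda>i. sqrt (inverse (A $$ (i, i))))"
    using A d by (simp add: diag_part_def pinv_mat_diag psd_sqrt_mat_diag)
  then show ?thesis
    unfolding corr_def using A
    by (auto simp: mat_diag_mult_left[OF A] mat_diag_mult_right[of _ n n] real_sqrt_inverse divide_inverse mult_ac
      intro!: eq_matI)
qed

subsection \<open>Gram matrices of submodels\<close>

text \<open>Gram entries are addressed by column number instead of position within a model; later
  estimates become sums over \<open>M\<close>, free of re-indexing.\<close>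

definition colprod :: "real Matrix.mat \<Rightarrow> nat \<Rightarrow> nat \<Rightarrow> real" where
  "colprod X i j = (\<Sum>k<dim_row X. X $$ (k, i) * X $$ (k, j))"

definition colcorr :: "real Matrix.mat \<Rightarrow> nat \<Rightarrow> nat \<Rightarrow> real" where
  "colcorr X i j = colprod X i j / (sqrt (colprod X i i) * sqrt (colprod X j j))"

lemma colprod_self_nonneg: "0 \<le> colprod X i i"
  unfolding colprod_def by (intro sum_nonneg) auto

lemma modelsD:
  assumes "M \<in> models p s"
  shows "finite M" "M \<subseteq> {..<p}" "M \<noteq> {}" "card M \<le> s"
  using assms finite_subset by (auto simp: models_def)

text \<open>\<open>pick M\<close> lists \<open>M\<close> in increasing order and its inverse is the
  rank; it translates sums over matrix positions into sums over \<open>M\<close>.\<close>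

lemma bij_betw_pick:
  assumes "finite M"
  shows "bij_betw (pick M) {..<card M} M"
proof (rule bij_betwI[where g = "\<lambda>i. card {j \<in> M. j < i}"])
  show "pick M \<in> {..<card M} \<rightarrow> M" using pick_in_set by auto
  show "(\<lambda>i. card {j \<in> M. j < i}) \<in> M \<rightarrow> {..<card M}"
    using assms by (auto intro!: psubset_card_mono)
qed (auto simp: card_pick pick_card_in_set)

lemma sum_pick: "finite M \<Longrightarrow> (\<Sum>a<card M. h (pick M a)) = (\<Sum>i\<in>M. h i)"
  by (rule sum.reindex_bij_betw[OF bij_betw_pick])

lemma L2_set_pick: "finite M \<Longrightarrow> L2_set (\<lambda>a. h (pick M a)) {..<card M} = L2_set h M"
  unfolding L2_set_def using sum_pick[of M "\<lambda>i. (h i)\<^sup>2"] by simp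

context
  fixes X :: "real Matrix.mat" and n p :: nat and M :: "nat set"
  assumes X: "X \<in> carrier_mat n p" and M: "M \<subseteq> {..<p}"
begin

lemma sub_cols_carrier: "sub_cols X M \<in> carrier_mat n (card M)"
proof -
  have "{j. j < p \<and> j \<in> M} = M" using M by auto
  then show ?thesis using X by (intro carrier_matI) (auto simp: sub_cols_def dim_submatrix)
qed

lemma sub_cols_index: "k < n \<Longrightarrow> a < card M \<Longrightarrow> sub_cols X M $$ (k, a) = X $$ (k, pick M a)"
proof -
  have "{j. j < p \<and> j \<in> M} = M" using M by auto
  then show "k < n \<Longrightarrow> a < card M \<Longrightarrow> sub_cols X M $$ (k, a) = X $$ (k, pick M a)"
    using X by (simp add: sub_cols_def submatrix_index pick_UNIV)
qed

lemma gram_carrier: "gram X M \<in> carrier_mat (card M) (card M)"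
  using sub_cols_carrier by (simp add: gram_def)

lemma gram_index:
  "a < card M \<Longrightarrow> b < card M \<Longrightarrow> gram X M $$ (a, b) = colprod X (pick M a) (pick M b)"
  using sub_cols_carrier X
  by (auto simp: gram_def colprod_def scalar_prod_def atLeast0LessThan sub_cols_index intro!: sum.cong)

lemma corr_gram_index:
  assumes "a < card M" "b < card M"
  shows "(corr (gram X M) - 1\<^sub>m (card M)) $$ (a, b) =
    colcorr X (pick M a) (pick M b) - of_bool (pick M a = pick M b)"
proof -
  have "finite M" using M finite_subset by blast
  then have "pick M a = pick M b \<longleftrightarrow> a = b"
    using bij_betw_imp_inj_on[OF bij_betw_pick] assms by (metis inj_on_eq_iff lessThan_iff)
  then show ?thesis
    using assms by (subst corr_eq[OF gram_carrier]) (auto simp: gram_index colprod_self_nonneg colcorr_def)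
qed

lemma corr_gram_carrier: "corr (gram X M) - 1\<^sub>m (card M) \<in> carrier_mat (card M) (card M)"
  by (subst corr_eq[OF gram_carrier]) (auto simp: gram_index colprod_self_nonneg)

end

subsection \<open>Operator norm\<close>

lemma vnorm_eq_L2_set: "vnorm v = L2_set (vec_index v) {..<dim_vec v}"
  by (simp add: vnorm_def L2_set_def scalar_prod_def atLeast0LessThan power2_eq_square)

lemma sum_mult_le_L2_set: "\<bar>\<Sum>i\<in>A. f i * g i\<bar> \<le> L2_set f A * L2_set g A"
proof -
  have "\<bar>\<Sum>i\<in>A. f i * g i\<bar> \<le> (\<Sum>i\<in>A. \<bar>f i\<bar> * \<bar>g i\<bar>)"
    using sum_abs[of "\<lambda>i. f i * g i" A] by (simp add: abs_mult)
  then show ?thesis using L2_set_mult_ineq by (rule order_trans)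
qed

lemma L2_set_scale: "L2_set (\<lambda>i. c * f i) A = \<bar>c\<bar> * L2_set f A" for c :: real
  unfolding L2_set_def by (simp add: power_mult_distrib sum_distrib_left[symmetric] real_sqrt_mult)

lemma L2_set_power2: "(L2_set f A)\<^sup>2 = (\<Sum>i\<in>A. (f i)\<^sup>2)"
  unfolding L2_set_def by (simp add: sum_nonneg)

lemma vnorm_smult: "vnorm (c \<cdot>\<^sub>v v) = \<bar>c\<bar> * vnorm v"
proof -
  have "L2_set (vec_index (c \<cdot>\<^sub>v v)) {..<dim_vec v} = L2_set (\<lambda>i. c * vec_index v i) {..<dim_vec v}"
    by (rule L2_set_cong) auto
  then show ?thesis by (simp add: vnorm_eq_L2_set L2_set_scale)
qed

text \<open>The supremum of reals in \<open>op_norm\<close> is meaningful only for a bounded set;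
  Cauchy-Schwarz in each row bounds it by the Frobenius norm.\<close>

lemma vnorm_mult_bdd_above:
  "bdd_above ((\<lambda>v. vnorm (A *\<^sub>v v)) ` {v \<in> carrier_vec (dim_col A). vnorm v \<le> 1})"
proof (rule bdd_aboveI2)
  fix v assume v: "v \<in> {v \<in> carrier_vec (dim_col A). vnorm v \<le> 1}"
  then have dv: "dim_vec v = dim_col A" by auto
  have "\<bar>vec_index (A *\<^sub>v v) i\<bar> \<le> L2_set (\<lambda>j. A $$ (i, j)) {..<dim_col A}" if "i < dim_row A" for i
  proof -
    have "vec_index (A *\<^sub>v v) i = (\<Sum>j<dim_col A. A $$ (i, j) * vec_index v j)"
      using that dv by (simp add: scalar_prod_def atLeast0LessThan)
    then have "\<bar>vec_index (A *\<^sub>v v) i\<bar> \<le> L2_set (\<lambda>j. A $$ (i, j)) {..<dim_col A} * vnorm v"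
      using dv sum_mult_le_L2_set[of "\<lambda>j. A $$ (i, j)" "vec_index v" "{..<dim_col A}"]
      by (simp add: vnorm_eq_L2_set)
    also have "\<dots> \<le> L2_set (\<lambda>j. A $$ (i, j)) {..<dim_col A} * 1"
      using v by (intro mult_left_mono) auto
    finally show ?thesis by simp
  qed
  then have "L2_set (\<lambda>i. \<bar>vec_index (A *\<^sub>v v) i\<bar>) {..<dim_row A}
      \<le> L2_set (\<lambda>i. L2_set (\<lambda>j. A $$ (i, j)) {..<dim_col A}) {..<dim_row A}"
    by (intro L2_set_mono) auto
  moreover have "L2_set (\<lambda>i. \<bar>vec_index (A *\<^sub>v v) i\<bar>) {..<dim_row A} = vnorm (A *\<^sub>v v)"
    by (simp add: vnorm_eq_L2_set L2_set_def)
  ultimately show "vnorm (A *\<^sub>v v) \<le> L2_set (\<lambda>i. L2_set (\<lambda>j. A $$ (i, j)) {..<dim_col A}) {..<dim_row A}"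
    by simp
qed

lemma vnorm_mult_le_op_norm:
  assumes v: "v \<in> carrier_vec (dim_col A)"
  shows "vnorm (A *\<^sub>v v) \<le> op_norm A * vnorm v"
proof (cases "vnorm v = 0")
  case True
  then have "\<forall>j<dim_col A. vec_index v j = 0"
    using v by (simp add: vnorm_eq_L2_set L2_set_eq_0_iff)
  then have "A *\<^sub>v v = 0\<^sub>v (dim_row A)" using v
    by (intro eq_vecI) (auto simp: scalar_prod_def)
  then have "vnorm (A *\<^sub>v v) = 0" by (simp add: vnorm_def)
  then show ?thesis using True by simp
next
  case False
  then have pos: "vnorm v > 0" by (simp add: vnorm_eq_L2_set less_le)
  define w where "w = (1 / vnorm v) \<cdot>\<^sub>v v"
  have "vnorm (A *\<^sub>v w) \<le> op_norm A" unfolding op_norm_def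
    by (intro cSUP_upper vnorm_mult_bdd_above) (use v pos in \<open>auto simp: w_def vnorm_smult\<close>)
  moreover have "A *\<^sub>v w = (1 / vnorm v) \<cdot>\<^sub>v (A *\<^sub>v v)"
    unfolding w_def using v by (intro mult_mat_vec[of _ "dim_row A" "dim_col A"]) auto
  ultimately show ?thesis using pos by (simp add: vnorm_smult field_simps)
qed

lemma op_norm_le:
  assumes "\<And>v. v \<in> carrier_vec (dim_col A) \<Longrightarrow> vnorm v \<le> 1 \<Longrightarrow> vnorm (A *\<^sub>v v) \<le> d"
  shows "op_norm A \<le> d"
  unfolding op_norm_def
proof (rule cSUP_least)
  have "0\<^sub>v (dim_col A) \<in> {v \<in> carrier_vec (dim_col A). vnorm v \<le> 1}" by (simp add: vnorm_def)
  then show "{v \<in> carrier_vec (dim_col A). vnorm v \<le> 1} \<noteq> {}" by blast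
qed (use assms in auto)

subsection \<open>The restricted isometry constant\<close>

lemma finite_models: "finite (models p s)"
  by (rule finite_subset[of _ "Pow {..<p}"]) (auto simp: models_def)

text \<open>With \<open>E\<close> the centred correlation matrix, the double sum is the bilinear
  form of \<open>E\<close> in \<open>f\<close> and \<open>g\<close>, bounded by Cauchy-Schwarz and
  the operator norm. The two vectors are kept distinct because the residual estimate pairs different
  ones.\<close>

lemma rip_delta_bilinear:
  assumes X: "X \<in> carrier_mat n p" and M: "M \<in> models p s" and d: "rip_delta X s \<le> d"
  shows "\<bar>\<Sum>i\<in>M. \<Sum>j\<in>M. f i * (colcorr X i j - of_bool (i = j)) * g j\<bar> \<le> d * L2_set f M * L2_set g M"
proof -
  note M' = modelsD[OF M]
  define E where "E = corr (gram X M) - 1\<^sub>m (card M)"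
  define u v where "u = Matrix.vec (card M) (\<lambda>a. f (pick M a))" and "v = Matrix.vec (card M) (\<lambda>a. g (pick M a))"
  have E: "E \<in> carrier_mat (card M) (card M)"
    unfolding E_def by (rule corr_gram_carrier[OF X M'(2)])
  have E_index: "E $$ (a, b) = colcorr X (pick M a) (pick M b) - of_bool (pick M a = pick M b)"
    if "a < card M" "b < card M" for a b
    unfolding E_def by (rule corr_gram_index[OF X M'(2) that])
  have vec: "vnorm (Matrix.vec (card M) (\<lambda>a. h (pick M a))) = L2_set h M" for h
    unfolding vnorm_eq_L2_set L2_set_pick[OF M'(1), symmetric] by (rule L2_set_cong) auto
  have "op_norm E \<le> rip_delta X s"
    unfolding rip_delta_def E_def using X M
    by (intro cSUP_upper2[OF bdd_above_finite]) (auto intro: finite_models)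
  then have op: "op_norm E \<le> d" using d by simp
  have "vnorm (E *\<^sub>v v) \<le> op_norm E * vnorm v"
    using E by (intro vnorm_mult_le_op_norm) (auto simp: v_def)
  also have "\<dots> \<le> d * vnorm v" using op by (intro mult_right_mono) (auto simp: vnorm_eq_L2_set)
  finally have Ev: "vnorm (E *\<^sub>v v) \<le> d * vnorm v" .
  have "(\<Sum>i\<in>M. \<Sum>j\<in>M. f i * (colcorr X i j - of_bool (i = j)) * g j)
    = (\<Sum>a<card M. \<Sum>b<card M. f (pick M a) * E $$ (a, b) * g (pick M b))"
    unfolding sum_pick[OF M'(1), symmetric]
    by (intro sum.cong refl) (simp add: E_index)
  also have "\<dots> = scalar_prod u (E *\<^sub>v v)"
    by (subst scalar_prod_mult_mat_vec[OF E]) (auto simp: u_def v_def)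
  also have "\<bar>\<dots>\<bar> \<le> vnorm u * vnorm (E *\<^sub>v v)"
    using E sum_mult_le_L2_set[of "vec_index u" "vec_index (E *\<^sub>v v)" "{..<card M}"]
    by (simp add: scalar_prod_def atLeast0LessThan vnorm_eq_L2_set u_def)
  also have "\<dots> \<le> vnorm u * (d * vnorm v)"
    by (intro mult_left_mono Ev) (simp add: vnorm_eq_L2_set)
  finally show ?thesis by (simp add: u_def v_def vec mult_ac)
qed

text \<open>The converse passage, from an estimate on sums over \<open>M\<close> to the operator
  norm; it certifies the design of the lower bound.\<close>

lemma rip_delta_le:
  assumes X: "X \<in> carrier_mat n p" and ne: "models p s \<noteq> {}" and d: "0 \<le> d"
    and bound: "\<And>M g. M \<in> models p s \<Longrightarrow>
      L2_set (\<lambda>i. \<Sum>j\<in>M. (colcorr X i j - of_bool (i = j)) * g j) M \<le> d * L2_set g M"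
  shows "rip_delta X s \<le> d"
  unfolding rip_delta_def
proof (rule cSUP_least)
  show "models (dim_col X) s \<noteq> {}" using X ne by simp
  fix M assume "M \<in> models (dim_col X) s"
  then have M: "M \<in> models p s" using X by simp
  note M' = modelsD[OF M]
  define E where "E = corr (gram X M) - 1\<^sub>m (card M)"
  have E: "E \<in> carrier_mat (card M) (card M)"
    unfolding E_def by (rule corr_gram_carrier[OF X M'(2)])
  have E_index: "E $$ (a, b) = colcorr X (pick M a) (pick M b) - of_bool (pick M a = pick M b)"
    if "a < card M" "b < card M" for a b
    unfolding E_def by (rule corr_gram_index[OF X M'(2) that])
  show "op_norm (corr (gram X M) - 1\<^sub>m (card M)) \<le> d"
    unfolding E_def[symmetric]
  proof (rule op_norm_le)
    fix v assume v: "v \<in> carrier_vec (dim_col E)" "vnorm v \<le> 1"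
    define g where "g i = vec_index v (card {j \<in> M. j < i})" for i
    have g: "g (pick M a) = vec_index v a" if "a < card M" for a
      using card_pick[of a M] that by (simp add: g_def)
    have Ev: "vec_index (E *\<^sub>v v) a = (\<Sum>j\<in>M. (colcorr X (pick M a) j - of_bool (pick M a = j)) * g j)"
      if "a < card M" for a
    proof -
      have "vec_index (E *\<^sub>v v) a = (\<Sum>b<card M. E $$ (a, b) * vec_index v b)"
        using E that v by (simp add: scalar_prod_def atLeast0LessThan)
      also have "\<dots> = (\<Sum>b<card M. (colcorr X (pick M a) (pick M b) - of_bool (pick M a = pick M b)) * g (pick M b))"
        using that by (intro sum.cong refl) (simp add: E_index g)
      also have "\<dots> = (\<Sum>j\<in>M. (colcorr X (pick M a) j - of_bool (pick M a = j)) * g j)"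
        by (rule sum_pick[OF M'(1), of "\<lambda>j. (colcorr X (pick M a) j - of_bool (pick M a = j)) * g j"])
      finally show ?thesis .
    qed
    have "vnorm (E *\<^sub>v v) = L2_set (\<lambda>a. \<Sum>j\<in>M. (colcorr X (pick M a) j - of_bool (pick M a = j)) * g j) {..<card M}"
      using E by (auto simp: vnorm_eq_L2_set Ev intro!: L2_set_cong)
    also have "\<dots> = L2_set (\<lambda>i. \<Sum>j\<in>M. (colcorr X i j - of_bool (i = j)) * g j) M"
      by (rule L2_set_pick[OF M'(1)])
    also have "\<dots> \<le> d * L2_set g M" using M by (rule bound)
    also have "L2_set g M = L2_set (\<lambda>a. g (pick M a)) {..<card M}" using L2_set_pick[OF M'(1)] by simp
    also have "\<dots> = vnorm v" using E v by (auto simp: vnorm_eq_L2_set g intro!: L2_set_cong)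
    also have "d * vnorm v \<le> d" using d v mult_left_le by blast
    finally show "vnorm (E *\<^sub>v v) \<le> d" .
  qed
qed


subsection \<open>The residual vectors\<close>

text \<open>These properties determine the residual vector: it lies in the span of the model's
  columns and has prescribed inner products with them. They replace all later computations with
  inverse matrices. Injectivity \<open>inj\<close> (full column rank) makes
  \<open>mat_inverse\<close> return a value.\<close>

lemma posi_v_characterization:
  assumes X: "X \<in> carrier_mat n p" and M: "M \<subseteq> {..<p}" and i: "i \<in> M"
    and inj: "\<And>c. (\<And>k. k < n \<Longrightarrow> (\<Sum>j\<in>M. c j * X $$ (k, j)) = 0) \<Longrightarrow> (\<forall>j\<in>M. c j = 0)"
  obtains c where "posi_v X M i \<in> carrier_vec n"
    and "\<And>k. k < n \<Longrightarrow> vec_index (posi_v X M i) k = (\<Sum>j\<in>M. c j * X $$ (k, j))"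
    and "\<And>j. j \<in> M \<Longrightarrow> (\<Sum>k<n. X $$ (k, j) * vec_index (posi_v X M i) k) = of_bool (j = i)"
proof -
  have fin: "finite M" using M finite_subset by blast
  define m S G where "m = card M" and "S = sub_cols X M" and "G = gram X M"
  have S: "S \<in> carrier_mat n m" unfolding S_def m_def by (rule sub_cols_carrier[OF X M])
  have G: "G \<in> carrier_mat m m" unfolding G_def m_def by (rule gram_carrier[OF X M])
  have GS: "G = transpose_mat S * S" by (simp add: G_def gram_def S_def)
  have rank: "rank_in (pick M a) M = a" if "a < m" for a
    using that card_pick[of a M] by (simp add: rank_in_def m_def)
  have S_mult: "vec_index (S *\<^sub>v v) k = (\<Sum>j\<in>M. vec_index v (rank_in j M) * X $$ (k, j))"
    if v: "v \<in> carrier_vec m" and k: "k < n" for v k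
  proof -
    have "vec_index (S *\<^sub>v v) k = (\<Sum>a<m. S $$ (k, a) * vec_index v a)"
      using v k S by (simp add: scalar_prod_def atLeast0LessThan)
    also have "\<dots> = (\<Sum>a<m. vec_index v (rank_in (pick M a) M) * X $$ (k, pick M a))"
      using k by (intro sum.cong refl) (simp add: rank S_def m_def sub_cols_index[OF X M])
    also have "\<dots> = (\<Sum>j\<in>M. vec_index v (rank_in j M) * X $$ (k, j))"
      unfolding m_def by (rule sum_pick[OF fin, of "\<lambda>j. vec_index v (rank_in j M) * X $$ (k, j)"])
    finally show ?thesis .
  qed
  \<comment> \<open>A kernel vector \<open>v\<close> of the Gram matrix satisfies
    \<open>|S v|^2 = v^t G v = 0\<close>, which \<open>inj\<close> excludes.\<close>
  have "det G \<noteq> 0"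
  proof
    assume "det G = 0"
    then obtain v where v: "v \<in> carrier_vec m" "v \<noteq> 0\<^sub>v m" "G *\<^sub>v v = 0\<^sub>v m"
      using det_0_iff_vec_prod_zero_field[OF G] by blast
    have Sv: "S *\<^sub>v v \<in> carrier_vec n" using S v by simp
    have "transpose_mat S *\<^sub>v (S *\<^sub>v v) = 0\<^sub>v m"
      using v S unfolding GS by (metis assoc_mult_mat_vec transpose_carrier_mat)
    then have "scalar_prod (S *\<^sub>v v) (S *\<^sub>v v) = 0"
      using transpose_vec_mult_scalar[OF S v(1) Sv] v(1) by simp
    then have "(\<Sum>k<n. (vec_index (S *\<^sub>v v) k)\<^sup>2) = 0"
      using carrier_vecD[OF Sv]
      by (simp add: scalar_prod_def atLeast0LessThan power2_eq_square
        del: index_mult_mat_vec dim_mult_mat_vec)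
    then have "\<forall>k\<in>{..<n}. (vec_index (S *\<^sub>v v) k)\<^sup>2 = 0"
      by (subst (asm) sum_nonneg_eq_0_iff) auto
    then have "\<forall>j\<in>M. vec_index v (rank_in j M) = 0"
      using S_mult[OF v(1)] by (intro inj) auto
    then have "vec_index v a = 0" if "a < m" for a
      using rank[OF that] that bij_betw_pick[OF fin] by (metis bij_betwE lessThan_iff m_def)
    then have "v = 0\<^sub>v m" using v(1) by (intro eq_vecI) auto
    then show False using v(2) by simp
  qed
  then have "G \<in> Units (ring_mat TYPE(real) m ())" by (rule det_non_zero_imp_unit[OF G])
  then obtain B where some: "mat_inverse G = Some B" using mat_inverse(1)[OF G, where b = "()"] by (cases "mat_inverse G") auto
  have B: "B * G = 1\<^sub>m m" "B \<in> carrier_mat m m" using mat_inverse(2)[OF G some] by auto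
  have GT: "transpose_mat G = G" unfolding GS using S by (simp add: transpose_mult[of _ m n _ m])
  define r h where "r = rank_in i M" and "h = transpose_mat B *\<^sub>v unit_vec m r"
  have r: "r < m" unfolding r_def rank_in_def m_def using i fin by (auto intro!: psubset_card_mono)
  have h: "h \<in> carrier_vec m" using B by (simp add: h_def)
  have pv: "posi_v X M i = S *\<^sub>v h"
  proof -
    have "posi_v X M i = transpose_mat (B * transpose_mat S) *\<^sub>v unit_vec m r"
      by (simp add: posi_v_def some[unfolded G_def] S_def m_def r_def)
    also have "transpose_mat (B * transpose_mat S) = S * transpose_mat B"
      using B S by (subst transpose_mult[of _ m m _ n]) auto
    finally show ?thesis using B S by (simp add: h_def assoc_mult_mat_vec[of _ n m _ m])
  qed
  \<comment> \<open>As \<open>G\<close> is symmetric, \<open>G * transpose_mat B\<close> is the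
    transpose of \<open>B * G = 1\<close>; so \<open>S h\<close> has inner product 1 with column
    \<open>i\<close> and 0 with the others.\<close>
  have "transpose_mat S *\<^sub>v (S *\<^sub>v h) = G *\<^sub>v h"
    unfolding GS using S h by (simp add: assoc_mult_mat_vec[of _ m n _ m])
  also have "\<dots> = (G * transpose_mat B) *\<^sub>v unit_vec m r"
    unfolding h_def using G B by (simp add: assoc_mult_mat_vec[of _ m m _ m])
  also have "G * transpose_mat B = transpose_mat (B * G)"
    using transpose_mult[OF B(2) G] GT by simp
  also have "\<dots> = 1\<^sub>m m" using B by simp
  finally have Sv: "transpose_mat S *\<^sub>v (S *\<^sub>v h) = unit_vec m r" by simp
  have "(\<Sum>k<n. X $$ (k, j) * vec_index (S *\<^sub>v h) k) = of_bool (j = i)" if j: "j \<in> M" for j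
  proof -
    have rj: "rank_in j M < m" unfolding rank_in_def m_def using j fin by (auto intro!: psubset_card_mono)
    have pj: "pick M (rank_in j M) = j" using j by (simp add: rank_in_def pick_card_in_set)
    have pr: "pick M r = i" using i by (simp add: r_def rank_in_def pick_card_in_set)
    have "(\<Sum>k<n. X $$ (k, j) * vec_index (S *\<^sub>v h) k)
        = (\<Sum>k<n. S $$ (k, rank_in j M) * vec_index (S *\<^sub>v h) k)"
      using rj by (intro sum.cong refl)
        (simp add: S_def m_def sub_cols_index[OF X M] pj del: index_mult_mat_vec)
    also have "\<dots> = vec_index (transpose_mat S *\<^sub>v (S *\<^sub>v h)) (rank_in j M)"
      using S rj by (simp add: scalar_prod_def atLeast0LessThan)
    also have "\<dots> = of_bool (rank_in j M = r)" using rj r by (simp add: Sv unit_vec_def)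
    also have "(rank_in j M = r) \<longleftrightarrow> j = i" by (metis pj pr r_def)
    finally show ?thesis .
  qed
  with that[of "\<lambda>j. vec_index h (rank_in j M)"] show ?thesis
    using S_mult[OF h] S h by (auto simp: pv)
qed

subsection \<open>Gaussian tails\<close>

abbreviation std_normal :: "real measure" where
  "std_normal \<equiv> density lborel std_normal_density"

lemma prob_space_std_normal: "prob_space std_normal"
  by (rule prob_space_normal_density) simp

lemma prob_space_std_gaussian: "prob_space (std_gaussian n)"
  unfolding std_gaussian_def by (intro prob_space_PiM prob_space_std_normal)

lemma measurable_std_gaussian_component:
  assumes "i < n" "f \<in> borel_measurable borel"
  shows "(\<lambda>\<xi>. f (\<xi> i)) \<in> borel_measurable (std_gaussian n)"
proof -
  have "(\<lambda>\<xi>. \<xi> i) \<in> measurable (std_gaussian n) std_normal"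
    unfolding std_gaussian_def using assms(1) by (intro measurable_component_singleton) simp
  also have "\<dots> = borel_measurable (std_gaussian n)"
    by (rule measurable_cong_sets) auto
  finally have "(\<lambda>\<xi>. \<xi> i) \<in> borel_measurable (std_gaussian n)" .
  then show ?thesis using assms(2) by (rule measurable_compose)
qed

lemma measurable_std_gaussian_sum:
  assumes "\<And>i. i < n \<Longrightarrow> g i \<in> borel_measurable borel"
  shows "(\<lambda>\<xi>. \<Sum>i<n. g i (\<xi> i) :: real) \<in> borel_measurable (std_gaussian n)"
  using assms by (intro borel_measurable_sum measurable_std_gaussian_component) auto

text \<open>Markov's inequality for the exponential of the sum, whose expectation factors over the
  independent coordinates. The coordinate functions are general because both linear forms and counts
  of large coordinates are treated this way.\<close>

lemma std_gaussian_chernoff: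
  fixes g :: "nat \<Rightarrow> real \<Rightarrow> real"
  assumes meas: "\<And>i. i < n \<Longrightarrow> g i \<in> borel_measurable borel"
    and mgf: "\<And>i. i < n \<Longrightarrow> (\<integral>\<^sup>+x. ennreal (exp (g i x)) \<partial>std_normal) \<le> ennreal (exp (c i))"
  shows "measure (std_gaussian n) {\<xi> \<in> space (std_gaussian n). b \<le> (\<Sum>i<n. g i (\<xi> i))}
    \<le> exp ((\<Sum>i<n. c i) - b)"
proof -
  interpret P: product_prob_space "\<lambda>_::nat. std_normal" "{..<n}"
    by (simp add: product_prob_space_def product_sigma_finite_def product_prob_space_axioms_def
      prob_space_std_normal prob_space_imp_sigma_finite)
  interpret G: prob_space "std_gaussian n" by (rule prob_space_std_gaussian)
  let ?G = "std_gaussian n"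
  define A where "A = {\<xi> \<in> space ?G. b \<le> (\<Sum>i<n. g i (\<xi> i))}"
  have [measurable]: "(\<lambda>\<xi>. \<Sum>i<n. g i (\<xi> i)) \<in> borel_measurable ?G"
    using meas by (rule measurable_std_gaussian_sum)
  have A: "A \<in> sets ?G" unfolding A_def by measurable
  have "emeasure ?G A = (\<integral>\<^sup>+\<xi>. indicator A \<xi> \<partial>?G)" using A by simp
  also have "\<dots> \<le> (\<integral>\<^sup>+\<xi>. ennreal (exp (- b)) * (\<Prod>i<n. ennreal (exp (g i (\<xi> i)))) \<partial>?G)"
  proof (rule nn_integral_mono)
    fix \<xi> assume "\<xi> \<in> space ?G"
    have "ennreal (exp (- b)) * (\<Prod>i<n. ennreal (exp (g i (\<xi> i)))) = ennreal (exp ((\<Sum>i<n. g i (\<xi> i)) - b))"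
      by (simp add: prod_ennreal exp_sum[symmetric] ennreal_mult'[symmetric] exp_add[symmetric] algebra_simps)
    moreover have "1 \<le> ennreal (exp ((\<Sum>i<n. g i (\<xi> i)) - b))" if "\<xi> \<in> A"
      using that by (simp add: A_def)
    ultimately show "indicator A \<xi> \<le> ennreal (exp (- b)) * (\<Prod>i<n. ennreal (exp (g i (\<xi> i))))"
      by (auto simp: indicator_def)
  qed
  also have "\<dots> = ennreal (exp (- b)) * (\<integral>\<^sup>+\<xi>. (\<Prod>i<n. ennreal (exp (g i (\<xi> i)))) \<partial>?G)"
    by (intro nn_integral_cmult borel_measurable_prod_ennreal measurable_compose[OF measurable_std_gaussian_component[OF _ meas]])
       auto
  also have "(\<integral>\<^sup>+\<xi>. (\<Prod>i<n. ennreal (exp (g i (\<xi> i)))) \<partial>?G)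
      = (\<Prod>i<n. \<integral>\<^sup>+x. ennreal (exp (g i x)) \<partial>std_normal)"
    unfolding std_gaussian_def
    using meas by (intro P.product_nn_integral_prod[of "{..<n}" "\<lambda>i x. ennreal (exp (g i x))"]) auto
  also have "\<dots> \<le> (\<Prod>i<n. ennreal (exp (c i)))"
    using mgf by (intro prod_mono_ennreal) auto
  also have "\<dots> = ennreal (exp (\<Sum>i<n. c i))"
    by (simp add: prod_ennreal exp_sum)
  finally have "emeasure ?G A \<le> ennreal (exp (- b)) * ennreal (exp (\<Sum>i<n. c i))"
    by (simp add: mult_left_mono)
  also have "\<dots> = ennreal (exp ((\<Sum>i<n. c i) - b))"
    by (simp add: ennreal_mult'[symmetric] exp_add[symmetric] algebra_simps)
  finally show ?thesis unfolding A_def[symmetric]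
    by (simp add: G.emeasure_eq_measure)
qed

text \<open>Completing the square turns \<open>exp (l * x)\<close> times the standard density into
  \<open>exp (l^2 / 2)\<close> times the density centred at \<open>l\<close>.\<close>

lemma std_normal_mgf: "(\<integral>\<^sup>+x. ennreal (exp (l * x)) \<partial>std_normal) = ennreal (exp (l\<^sup>2 / 2))"
proof -
  have "(\<integral>\<^sup>+x. ennreal (exp (l * x)) \<partial>std_normal)
      = (\<integral>\<^sup>+x. ennreal (exp (l\<^sup>2 / 2)) * ennreal (normal_density l 1 x) \<partial>lborel)"
    by (subst nn_integral_density)
       (auto intro!: nn_integral_cong simp: ennreal_mult'[symmetric] normal_density_def
         exp_add[symmetric] field_simps power2_eq_square)
  also have "\<dots> = ennreal (exp (l\<^sup>2 / 2)) * (\<integral>\<^sup>+x. ennreal (normal_density l 1 x) \<partial>lborel)"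
    by (rule nn_integral_cmult) auto
  also have "(\<integral>\<^sup>+x. ennreal (normal_density l 1 x) \<partial>lborel) = 1"
    by (subst nn_integral_eq_integral) auto
  finally show ?thesis by simp
qed

lemma std_gaussian_linear_tail:
  assumes "0 < \<sigma>" "(\<Sum>i<n. (u i)\<^sup>2) \<le> \<sigma>\<^sup>2" "0 \<le> t"
  shows "measure (std_gaussian n) {\<xi> \<in> space (std_gaussian n). t \<le> (\<Sum>i<n. u i * \<xi> i)}
    \<le> exp (- t\<^sup>2 / (2 * \<sigma>\<^sup>2))"
proof (cases "t = 0")
  case True
  then show ?thesis using prob_space.prob_le_1[OF prob_space_std_gaussian] by simp
next
  case False
  \<comment> \<open>The value of \<open>l\<close> minimizing the Chernoff exponent
    \<open>l^2 \<sigma>^2 / 2 - l t\<close>.\<close>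
  define l where "l = t / \<sigma>\<^sup>2"
  have l: "l > 0" using False assms by (simp add: l_def)
  have "{\<xi> \<in> space (std_gaussian n). t \<le> (\<Sum>i<n. u i * \<xi> i)}
     = {\<xi> \<in> space (std_gaussian n). l * t \<le> (\<Sum>i<n. (l * u i) * \<xi> i)}"
    using l by (simp add: mult.assoc sum_distrib_left[symmetric])
  also have "measure (std_gaussian n) \<dots> \<le> exp ((\<Sum>i<n. (l * u i)\<^sup>2 / 2) - l * t)"
    by (rule std_gaussian_chernoff[where g = "\<lambda>i x. l * u i * x"]) (simp_all add: std_normal_mgf)
  also have "(\<Sum>i<n. (l * u i)\<^sup>2 / 2) = l\<^sup>2 / 2 * (\<Sum>i<n. (u i)\<^sup>2)"
    by (simp add: sum_distrib_left power_mult_distrib)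
  also have "l\<^sup>2 / 2 * (\<Sum>i<n. (u i)\<^sup>2) \<le> l\<^sup>2 / 2 * \<sigma>\<^sup>2"
    using assms by (intro mult_left_mono) auto
  also have "l\<^sup>2 / 2 * \<sigma>\<^sup>2 - l * t = - t\<^sup>2 / (2 * \<sigma>\<^sup>2)"
    using assms(1) by (simp add: l_def field_simps power2_eq_square)
  finally show ?thesis by simp
qed

lemma std_gaussian_linear_abs_tail:
  assumes "0 < \<sigma>" "(\<Sum>i<n. (u i)\<^sup>2) \<le> \<sigma>\<^sup>2" "0 \<le> t"
  shows "measure (std_gaussian n) {\<xi> \<in> space (std_gaussian n). t \<le> \<bar>\<Sum>i<n. u i * \<xi> i\<bar>}
    \<le> 2 * exp (- t\<^sup>2 / (2 * \<sigma>\<^sup>2))"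
proof -
  interpret G: prob_space "std_gaussian n" by (rule prob_space_std_gaussian)
  let ?A = "\<lambda>u. {\<xi> \<in> space (std_gaussian n). t \<le> (\<Sum>i<n. u i * \<xi> i)}"
  have meas: "?A v \<in> G.events" for v
  proof -
    have [measurable]: "(\<lambda>\<xi>. \<Sum>i<n. v i * \<xi> i) \<in> borel_measurable (std_gaussian n)"
      by (rule measurable_std_gaussian_sum) auto
    show ?thesis by measurable
  qed
  have "{\<xi> \<in> space (std_gaussian n). t \<le> \<bar>\<Sum>i<n. u i * \<xi> i\<bar>} = ?A u \<union> ?A (\<lambda>i. - u i)"
    by (auto simp: sum_negf abs_if)
  then have "measure (std_gaussian n) {\<xi> \<in> space (std_gaussian n). t \<le> \<bar>\<Sum>i<n. u i * \<xi> i\<bar>}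
     \<le> measure (std_gaussian n) (?A u) + measure (std_gaussian n) (?A (\<lambda>i. - u i))"
    using measure_Un_le[OF meas[of u] meas[of "\<lambda>i. - u i"]] by simp
  also have "\<dots> \<le> exp (- t\<^sup>2 / (2 * \<sigma>\<^sup>2)) + exp (- t\<^sup>2 / (2 * \<sigma>\<^sup>2))"
    using assms by (intro add_mono std_gaussian_linear_tail) auto
  finally show ?thesis by simp
qed

text \<open>Union bound: the threshold makes each two-sided tail at most \<open>\<beta> / N\<close>,
  and \<open>\<beta> \<le> 2 * N\<close> keeps the logarithm nonnegative.\<close>

lemma std_gaussian_max_tail:
  assumes "finite J" "0 < \<sigma>" "\<And>j. j \<in> J \<Longrightarrow> (\<Sum>i<n. (u j i)\<^sup>2) \<le> \<sigma>\<^sup>2"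
    and "real (card J) \<le> N" "0 < \<beta>" "\<beta> \<le> 2 * N"
  shows "measure (std_gaussian n) {\<xi> \<in> space (std_gaussian n).
       \<exists>j\<in>J. \<sigma> * sqrt (2 * ln (2 * N / \<beta>)) \<le> \<bar>\<Sum>i<n. u j i * \<xi> i\<bar>} \<le> \<beta>"
proof -
  interpret G: prob_space "std_gaussian n" by (rule prob_space_std_gaussian)
  define t where "t = \<sigma> * sqrt (2 * ln (2 * N / \<beta>))"
  have N: "N > 0" using assms by linarith
  have ln: "ln (2 * N / \<beta>) \<ge> 0" using assms N by simp
  then have t: "t \<ge> 0" using assms by (simp add: t_def)
  let ?A = "\<lambda>j. {\<xi> \<in> space (std_gaussian n). t \<le> \<bar>\<Sum>i<n. u j i * \<xi> i\<bar>}"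
  have meas: "?A j \<in> G.events" for j
  proof -
    have [measurable]: "(\<lambda>\<xi>. \<Sum>i<n. u j i * \<xi> i) \<in> borel_measurable (std_gaussian n)"
      by (rule measurable_std_gaussian_sum) auto
    show ?thesis by measurable
  qed
  have "- t\<^sup>2 / (2 * \<sigma>\<^sup>2) = - ln (2 * N / \<beta>)"
    using ln assms by (simp add: t_def power_mult_distrib)
  then have e: "exp (- t\<^sup>2 / (2 * \<sigma>\<^sup>2)) = \<beta> / (2 * N)"
    using N assms by (simp add: exp_minus)
  have "{\<xi> \<in> space (std_gaussian n). \<exists>j\<in>J. t \<le> \<bar>\<Sum>i<n. u j i * \<xi> i\<bar>} = (\<Union>j\<in>J. ?A j)"
    by auto
  also have "measure (std_gaussian n) \<dots> \<le> (\<Sum>j\<in>J. measure (std_gaussian n) (?A j))"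
    using assms meas by (intro G.finite_measure_subadditive_finite) auto
  also have "\<dots> \<le> (\<Sum>j\<in>J. 2 * (\<beta> / (2 * N)))"
    using std_gaussian_linear_abs_tail[OF assms(2,3) t] unfolding e by (intro sum_mono) auto
  also have "\<dots> = card J * (\<beta> / N)" by simp
  also have "\<dots> \<le> N * (\<beta> / N)" using N assms by (intro mult_right_mono) auto
  finally show ?thesis using N by (simp add: t_def)
qed

text \<open>On \<open>{T..T+1}\<close> the density is at least its value at \<open>T + 1\<close>,
  and \<open>(T + 1)^2 \<le> 2 * T^2 + 2\<close>. The exponent \<open>T^2\<close> suits the later
  choice \<open>T = sqrt (ln m)\<close>, which makes the bound a constant over
  \<open>m\<close>.\<close>

lemma std_normal_upper_tail_ge:
  assumes "0 \<le> T"
  shows "exp (- T\<^sup>2 - 1) / sqrt (2 * pi) \<le> measure std_normal {T..}"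
proof -
  interpret prob_space std_normal by (rule prob_space_std_normal)
  have "ennreal (exp (- T\<^sup>2 - 1) / sqrt (2 * pi)) = (\<integral>\<^sup>+x. ennreal (exp (- T\<^sup>2 - 1) / sqrt (2 * pi)) * indicator {T..T+1} x \<partial>lborel)"
    by (simp add: nn_integral_cmult_indicator)
  also have "\<dots> \<le> (\<integral>\<^sup>+x. ennreal (std_normal_density x) * indicator {T..} x \<partial>lborel)"
  proof (rule nn_integral_mono)
    fix x
    show "ennreal (exp (- T\<^sup>2 - 1) / sqrt (2 * pi)) * indicator {T..T+1} x \<le> ennreal (std_normal_density x) * indicator {T..} x"
    proof (cases "x \<in> {T..T+1}")
      case True
      have "x\<^sup>2 \<le> (T + 1)\<^sup>2" using True assms by (intro power_mono) auto
      also have "\<dots> \<le> 2 * (T\<^sup>2 + 1)" using sum_squares_bound[of T 1] by (simp add: power2_eq_square algebra_simps)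
      finally have "exp (- T\<^sup>2 - 1) \<le> exp (- x\<^sup>2 / 2)" by simp
      then show ?thesis using True by (simp add: std_normal_density_def divide_right_mono)
    qed auto
  qed
  also have "\<dots> = emeasure std_normal {T..}" by (subst emeasure_density) auto
  finally show ?thesis by (simp add: emeasure_eq_measure)
qed

section \<open>Number of large coordinates of a Gaussian vector\<close>

lemma real_card_upper_eq_sum:
  fixes T :: real and k :: nat
  shows "real (card {j. j < k \<and> T \<le> \<xi> j}) = (\<Sum>j<k. indicator {T..} (\<xi> j))"
proof -
  have "{j. j < k \<and> T \<le> \<xi> j} = {..<k} \<inter> {j. T \<le> \<xi> j}" by auto
  then show ?thesis by (simp add: indicator_def sum_of_bool_eq)
qed

text \<open>Chernoff bound for minus the number of exceedances: an indicator \<open>I\<close> of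
  probability \<open>q\<close> has \<open>E exp (- I) = 1 - (1 - 1/e) q\<close>, which is at most
  \<open>exp (- (1 - 1/e) q)\<close>.\<close>

lemma std_gaussian_count_lower_tail:
  fixes T q :: real and k n :: nat
  assumes "k \<le> n"
  defines "q \<equiv> measure std_normal {T..}"
  shows "measure (std_gaussian n) {\<xi> \<in> space (std_gaussian n).
      real (card {j. j < k \<and> T \<le> \<xi> j}) \<le> k * q / 2} \<le> exp (- (k * q / 10))"
proof -
  interpret S: prob_space std_normal by (rule prob_space_std_normal)
  define g where "g i x = (if i < k then - indicator {T..} x else 0 :: real)" for i x
  define e1 where "e1 = 1 - exp (-1 :: real)"
  define c where "c i = (if i < k then - e1 * q else 0)" for i
  have q: "0 \<le> q" by (simp add: q_def)
  \<comment> \<open>This gives \<open>e1 \<ge> 3/5\<close>; the excess of 3/5 over the 1/2 in the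
    threshold is the 1/10 in the exponent.\<close>
  have "exp (1::real) \<ge> 5/2" using exp_lower_Taylor_quadratic[of 1] by simp
  then have "exp (-1::real) \<le> 2/5" by (simp add: exp_minus field_simps)
  then have e1: "e1 \<ge> 3/5" by (simp add: e1_def)
  have sum: "(\<Sum>i<n. g i (\<xi> i)) = - real (card {j. j < k \<and> T \<le> \<xi> j})" for \<xi> :: "nat \<Rightarrow> real"
  proof -
    have "(\<Sum>i<n. g i (\<xi> i)) = (\<Sum>i\<in>{..<k}. - (indicator {T..} (\<xi> i) :: real))"
      unfolding g_def using assms(1)
      by (intro sum.mono_neutral_cong_right) auto
    also have "\<dots> = - real (card {j. j < k \<and> T \<le> \<xi> j})"
      unfolding real_card_upper_eq_sum by (simp add: sum_negf)
    finally show ?thesis .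
  qed
  have "measure (std_gaussian n) {\<xi> \<in> space (std_gaussian n). - (k * q / 2) \<le> (\<Sum>i<n. g i (\<xi> i))}
     \<le> exp ((\<Sum>i<n. c i) - (- (k * q / 2)))"
  proof (rule std_gaussian_chernoff)
    show "g i \<in> borel_measurable borel" for i unfolding g_def by measurable
    show "(\<integral>\<^sup>+x. ennreal (exp (g i x)) \<partial>std_normal) \<le> ennreal (exp (c i))" for i
    proof (cases "i < k")
      case True
      have "(\<integral>\<^sup>+x. ennreal (exp (g i x)) \<partial>std_normal) = (\<integral>\<^sup>+x. ennreal (1 - e1 * indicator {T..} x) \<partial>std_normal)"
        using True by (intro nn_integral_cong) (auto simp: g_def e1_def indicator_def)
      also have "\<dots> = ennreal (\<integral>x. 1 - e1 * indicator {T..} x \<partial>std_normal)"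
      proof (rule nn_integral_eq_integral)
        show "integrable std_normal (\<lambda>x. 1 - e1 * indicator {T..} x)"
          by (intro Bochner_Integration.integrable_diff integrable_mult_right integrable_real_indicator)
             (auto simp: S.emeasure_eq_measure)
      qed (auto simp: e1_def indicator_def)
      also have "(\<integral>x. 1 - e1 * indicator {T..} x \<partial>std_normal) = 1 - e1 * q"
        using S.prob_space by (simp add: q_def S.emeasure_eq_measure)
      also have "ennreal (1 - e1 * q) \<le> ennreal (exp (- (e1 * q)))"
        using exp_ge_add_one_self[of "- (e1 * q)"] by (intro ennreal_leI) simp
      finally show ?thesis using True by (simp add: c_def)
    next
      case False
      then show ?thesis using S.emeasure_space_1 by (simp add: g_def c_def)
    qed
  qed
  also have "(\<Sum>i<n. c i) = (\<Sum>i<k. - e1 * q)"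
    unfolding c_def using assms(1) by (intro sum.mono_neutral_cong_right) auto
  also have "\<dots> - (- (k * q / 2)) \<le> - (k * q / 10)"
    using mult_right_mono[OF e1, of "k * q"] q by (simp add: algebra_simps)
  finally show ?thesis by (simp add: sum)
qed

subsection \<open>Perturbation of the residual vectors\<close>

text \<open>Column \<open>i\<close> normalized, at row \<open>k\<close>. A zero column stays zero,
  so the norm is at most 1 in every case.\<close>

definition unit_col :: "real Matrix.mat \<Rightarrow> nat \<Rightarrow> nat \<Rightarrow> real" where
  "unit_col X k i = X $$ (k, i) / sqrt (colprod X i i)"

lemma colcorr_eq: "X \<in> carrier_mat n p \<Longrightarrow> colcorr X i j = (\<Sum>k<n. unit_col X k i * unit_col X k j)"
  by (simp add: colcorr_def colprod_def unit_col_def sum_divide_distrib)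

lemma sum_unit_col_power2_le: "X \<in> carrier_mat n p \<Longrightarrow> (\<Sum>k<n. (unit_col X k i)\<^sup>2) \<le> 1"
proof -
  assume X: "X \<in> carrier_mat n p"
  have "(\<Sum>k<n. (unit_col X k i)\<^sup>2) = colcorr X i i"
    by (simp add: colcorr_eq[OF X] power2_eq_square)
  also have "\<dots> \<le> 1"
    using colprod_self_nonneg[of X i] by (cases "colprod X i i = 0") (auto simp: colcorr_def)
  finally show ?thesis .
qed

context
  fixes X :: "real Matrix.mat" and n p s :: nat and d :: real and M :: "nat set"
  assumes X: "X \<in> carrier_mat n p" and M: "M \<in> models p s" and rip: "rip_delta X s \<le> d"
begin

text \<open>For a zero column the singleton model would have deviation
  \<open>\<bar>0 - 1\<bar> = 1\<close>, which exceeds \<open>d\<close>.\<close>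

lemma rip_colprod_pos:
  assumes "d < 1" "i \<in> M"
  shows "0 < colprod X i i"
proof -
  have "1 \<le> card M" using modelsD[OF M] by (simp add: Suc_le_eq card_gt_0_iff)
  then have "{i} \<in> models p s" using assms(2) modelsD[OF M] by (auto simp: models_def)
  from rip_delta_bilinear[OF X this rip, of "\<lambda>_. 1" "\<lambda>_. 1"]
  have "\<bar>colcorr X i i - 1\<bar> \<le> d" by simp
  then have "colcorr X i i \<noteq> 0" using assms(1) by auto
  then have "colprod X i i \<noteq> 0" by (auto simp: colcorr_def)
  then show ?thesis using colprod_self_nonneg[of X i] by simp
qed

text \<open>Inner products of combinations of normalized columns differ from those of the
  coefficient vectors by the bilinear form of the centred correlation matrix.\<close>

lemma rip_inner:
  "\<bar>(\<Sum>k<n. (\<Sum>i\<in>M. f i * unit_col X k i) * (\<Sum>j\<in>M. g j * unit_col X k j)) - (\<Sum>i\<in>M. f i * g i)\<bar>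
    \<le> d * L2_set f M * L2_set g M"
proof -
  have fin: "finite M" using modelsD[OF M] by simp
  have "(\<Sum>i\<in>M. \<Sum>j\<in>M. f i * (colcorr X i j - of_bool (i = j)) * g j)
     = (\<Sum>i\<in>M. \<Sum>j\<in>M. f i * colcorr X i j * g j) - (\<Sum>i\<in>M. \<Sum>j\<in>M. if i = j then f i * g j else 0)"
    unfolding sum_subtractf[symmetric] by (intro sum.cong refl) (simp add: algebra_simps)
  also have "(\<Sum>i\<in>M. \<Sum>j\<in>M. if i = j then f i * g j else 0) = (\<Sum>i\<in>M. f i * g i)"
    using fin by (intro sum.cong refl) simp
  also have "(\<Sum>i\<in>M. \<Sum>j\<in>M. f i * colcorr X i j * g j)
     = (\<Sum>i\<in>M. \<Sum>j\<in>M. \<Sum>k<n. (f i * unit_col X k i) * (g j * unit_col X k j))"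
    unfolding colcorr_eq[OF X] by (intro sum.cong refl) (simp add: sum_distrib_left mult_ac)
  also have "\<dots> = (\<Sum>i\<in>M. \<Sum>k<n. \<Sum>j\<in>M. (f i * unit_col X k i) * (g j * unit_col X k j))"
    by (intro sum.cong refl sum.swap)
  also have "\<dots> = (\<Sum>k<n. \<Sum>i\<in>M. \<Sum>j\<in>M. (f i * unit_col X k i) * (g j * unit_col X k j))"
    by (rule sum.swap)
  also have "\<dots> = (\<Sum>k<n. (\<Sum>i\<in>M. f i * unit_col X k i) * (\<Sum>j\<in>M. g j * unit_col X k j))"
    by (simp add: sum_product)
  finally show ?thesis using rip_delta_bilinear[OF X M rip, of f g] by simp
qed

lemma rip_inner_self:
  "\<bar>(\<Sum>k<n. (\<Sum>i\<in>M. f i * unit_col X k i)\<^sup>2) - (L2_set f M)\<^sup>2\<bar> \<le> d * (L2_set f M)\<^sup>2"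
  using rip_inner[of f f] by (simp add: L2_set_power2 power2_eq_square[symmetric] mult.assoc)

lemma unit_col_combination:
  assumes "d < 1"
  shows "(\<Sum>j\<in>M. c j * X $$ (k, j)) = (\<Sum>j\<in>M. (c j * sqrt (colprod X j j)) * unit_col X k j)"
  using rip_colprod_pos[OF assms] by (intro sum.cong refl) (fastforce simp: unit_col_def)

text \<open>The squared norm of a combination is at least \<open>1 - d\<close> times that of its
  coefficients. This supplies the full rank for \<open>posi_v_characterization\<close>.\<close>

lemma rip_injective:
  assumes d: "d < 1" and zero: "\<And>k. k < n \<Longrightarrow> (\<Sum>j\<in>M. c j * X $$ (k, j)) = 0"
  shows "\<forall>j\<in>M. c j = 0"
proof -
  define f where "f j = c j * sqrt (colprod X j j)" for j
  have "(\<Sum>k<n. (\<Sum>j\<in>M. f j * unit_col X k j)\<^sup>2) = 0"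
    using zero unit_col_combination[OF d] by (simp add: f_def)
  then have "(1 - d) * (L2_set f M)\<^sup>2 \<le> 0"
    using rip_inner_self[of f] by (simp add: algebra_simps)
  then have "(L2_set f M)\<^sup>2 = 0" using d by (simp add: mult_le_0_iff)
  then have "\<forall>j\<in>M. f j = 0" using modelsD(1)[OF M] by (simp add: L2_set_eq_0_iff)
  then show ?thesis using rip_colprod_pos[OF d] by (fastforce simp: f_def)
qed

text \<open>Let \<open>f\<close> be the coordinates of \<open>v\<close> in the normalized columns. As \<open>v\<close> is orthogonal to all columns
  but the \<open>i\<close>-th, testing the restricted isometry property with \<open>\<tau> e\<^sub>i - f\<close> and \<open>f\<close> bounds the norm of \<open>\<tau> e\<^sub>i - f\<close> by \<open>d\<close> times
  that of \<open>f\<close>.\<close>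

lemma posi_w_perturbation:
  assumes d: "d \<le> 1/2" and i: "i \<in> M"
  obtains \<tau> z where "\<bar>\<tau>\<bar> \<le> 1" "(\<Sum>k<n. (z k)\<^sup>2) \<le> (2 * d)\<^sup>2"
    "\<And>k. k < n \<Longrightarrow> vec_index (posi_w X M i) k = \<tau> * unit_col X k i + z k"
proof -
  have d1: "d < 1" using d by simp
  have fin: "finite M" using modelsD[OF M] by simp
  obtain c where vc: "posi_v X M i \<in> carrier_vec n"
    and vk: "\<And>k. k < n \<Longrightarrow> vec_index (posi_v X M i) k = (\<Sum>j\<in>M. c j * X $$ (k, j))"
    and vX: "\<And>j. j \<in> M \<Longrightarrow> (\<Sum>k<n. X $$ (k, j) * vec_index (posi_v X M i) k) = of_bool (j = i)"
    using posi_v_characterization[OF X modelsD(2)[OF M] i rip_injective[OF d1]] by blast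
  define v where "v k = vec_index (posi_v X M i) k" for k
  define f where "f j = c j * sqrt (colprod X j j)" for j
  \<comment> \<open>As \<open>v\<close> has inner product 1 with column \<open>i\<close>,
    \<open>\<tau>\<close> is its inner product with the normalized column. The multiple finally
    returned is \<open>\<tau> / N\<close>.\<close>
  define \<tau> where "\<tau> = 1 / sqrt (colprod X i i)"
  define N F where "N = L2_set v {..<n}" and "F = L2_set f M"
  have N0: "N \<ge> 0" and F0: "F \<ge> 0" by (simp_all add: N_def F_def)
  have \<tau>: "\<tau> > 0" using rip_colprod_pos[OF d1 i] by (simp add: \<tau>_def)
  have vf: "v k = (\<Sum>j\<in>M. f j * unit_col X k j)" if "k < n" for k
    using vk[OF that] by (simp add: v_def f_def unit_col_combination[OF d1])
  have uv: "(\<Sum>k<n. unit_col X k j * v k) = (if j = i then \<tau> else 0)" if "j \<in> M" for j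
  proof -
    have "(\<Sum>k<n. unit_col X k j * v k) = (\<Sum>k<n. X $$ (k, j) * v k) / sqrt (colprod X j j)"
      by (simp add: unit_col_def sum_divide_distrib)
    then show ?thesis using vX[OF that] by (simp add: v_def \<tau>_def)
  qed
  have gv: "(\<Sum>k<n. (\<Sum>j\<in>M. g j * unit_col X k j) * v k) = g i * \<tau>" for g
  proof -
    have "(\<Sum>k<n. (\<Sum>j\<in>M. g j * unit_col X k j) * v k) = (\<Sum>j\<in>M. g j * (\<Sum>k<n. unit_col X k j * v k))"
      unfolding sum_distrib_left sum_distrib_right by (subst sum.swap) (simp add: mult.assoc)
    also have "\<dots> = (\<Sum>j\<in>M. if j = i then g j * \<tau> else 0)" using uv by (intro sum.cong refl) auto
    finally show ?thesis using fin i by simp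
  qed
  have "(1 - d) * F\<^sup>2 \<le> N\<^sup>2"
    using rip_inner_self[of f] vf by (simp add: N_def F_def L2_set_power2 algebra_simps)
  moreover have "1/2 * F\<^sup>2 \<le> (1 - d) * F\<^sup>2" using d by (intro mult_right_mono) auto
  ultimately have FN: "F\<^sup>2 \<le> 2 * N\<^sup>2" by simp
  have \<tau>N: "\<tau> \<le> N"
  proof -
    have "\<tau> = \<bar>\<Sum>k<n. unit_col X k i * v k\<bar>" using uv[OF i] \<tau> by simp
    also have "\<dots> \<le> L2_set (\<lambda>k. unit_col X k i) {..<n} * N"
      unfolding N_def by (rule sum_mult_le_L2_set)
    also have "\<dots> \<le> 1 * N"
      using sum_unit_col_power2_le[OF X, of i] N0 by (intro mult_right_mono) (auto simp: L2_set_def)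
    finally show ?thesis by simp
  qed
  then have Npos: "N > 0" using \<tau> by linarith
  define u where "u j = (if j = i then \<tau> else 0) - f j" for j
  define U where "U = L2_set u M"
  \<comment> \<open>Pairing the combination of columns given by \<open>u\<close> with
    \<open>v\<close> yields \<open>u i * \<tau>\<close>, so the deviation in
    \<open>rip_inner\<close> for \<open>u\<close> and \<open>f\<close> is exactly
    \<open>U^2\<close>.\<close>
  have "u i * \<tau> - (\<Sum>j\<in>M. u j * f j) = (\<Sum>j\<in>M. if j = i then u j * \<tau> else 0) - (\<Sum>j\<in>M. u j * f j)"
    using fin i by simp
  also have "\<dots> = U\<^sup>2"
    unfolding sum_subtractf[symmetric] U_def L2_set_power2
    by (intro sum.cong refl) (auto simp: u_def power2_eq_square algebra_simps)
  finally have "U\<^sup>2 \<le> d * U * F"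
    using rip_inner[of u f] gv[of u] vf by (simp add: U_def F_def)
  have U: "U\<^sup>2 \<le> d\<^sup>2 * F\<^sup>2"
  proof (cases "U = 0")
    case False
    then have "U > 0" by (simp add: U_def less_le)
    then have "U \<le> d * F" using \<open>U\<^sup>2 \<le> d * U * F\<close> by (simp add: power2_eq_square mult_ac)
    then have "U\<^sup>2 \<le> (d * F)\<^sup>2" using \<open>U > 0\<close> by (intro power_mono) auto
    then show ?thesis by (simp add: power_mult_distrib)
  qed simp
  define z where "z k = (v k - \<tau> * unit_col X k i) / N" for k
  have "(\<Sum>j\<in>M. u j * unit_col X k j) = - (v k - \<tau> * unit_col X k i)" if "k < n" for k
  proof -
    have "(\<Sum>j\<in>M. u j * unit_col X k j) = (\<Sum>j\<in>M. if j = i then \<tau> * unit_col X k j else 0) - v k"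
      unfolding vf[OF that] sum_subtractf[symmetric]
      by (intro sum.cong refl) (auto simp: u_def algebra_simps)
    then show ?thesis using fin i by simp
  qed
  then have "(\<Sum>k<n. (z k)\<^sup>2) = (\<Sum>k<n. (\<Sum>j\<in>M. u j * unit_col X k j)\<^sup>2) / N\<^sup>2"
    by (simp add: z_def power_divide sum_divide_distrib power2_commute)
  also have "\<dots> \<le> ((1 + d) * U\<^sup>2) / N\<^sup>2"
    using rip_inner_self[of u] by (intro divide_right_mono) (auto simp: U_def algebra_simps)
  \<comment> \<open>\<open>1 + d \<le> 3/2\<close> and
    \<open>U^2 \<le> d^2 F^2 \<le> 2 d^2 N^2\<close> together give \<open>3 d^2\<close>, rounded up
    to \<open>4 d^2\<close>.\<close>
  also have "\<dots> \<le> (3/2 * (d\<^sup>2 * (2 * N\<^sup>2))) / N\<^sup>2"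
    using d U mult_left_mono[OF FN, of "d\<^sup>2"] by (intro divide_right_mono mult_mono) auto
  also have "\<dots> \<le> (2 * d)\<^sup>2" using Npos by (simp add: power_mult_distrib)
  finally have zb: "(\<Sum>k<n. (z k)\<^sup>2) \<le> (2 * d)\<^sup>2" .
  have vn: "vnorm (posi_v X M i) = N"
    using vc by (simp add: vnorm_eq_L2_set N_def v_def[abs_def])
  then have "posi_v X M i \<noteq> 0\<^sub>v n" using Npos by (auto simp: vnorm_def)
  then have "vec_index (posi_w X M i) k = \<tau> / N * unit_col X k i + z k" if "k < n" for k
    using that X vc Npos by (simp add: posi_w_def vn z_def v_def field_simps)
  moreover have "\<bar>\<tau> / N\<bar> \<le> 1" using \<tau> \<tau>N Npos by simp
  ultimately show ?thesis using zb that by blast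
qed

end

subsection \<open>Quantiles of the maximum\<close>

lemma (in prob_space) quantile_le:
  assumes "0 < q" "q \<le> prob {x \<in> space M. Y x \<le> t}" "\<And>x. x \<in> space M \<Longrightarrow> 0 \<le> Y x"
  shows "quantile M Y q \<le> t"
  unfolding quantile_def
proof (rule cInf_lower)
  show "bdd_below {t. q \<le> prob {x \<in> space M. Y x \<le> t}}"
  proof (rule bdd_belowI)
    fix t assume "t \<in> {t. q \<le> prob {x \<in> space M. Y x \<le> t}}"
    then have "{x \<in> space M. Y x \<le> t} \<noteq> {}" using assms(1) by (metis mem_Collect_eq measure_empty not_le)
    then obtain x where "x \<in> space M" "Y x \<le> t" by blast
    then show "0 \<le> t" using assms(3) by fastforce
  qed
qed (use assms in auto)

text \<open>The infimum of reals requires a non-empty set of thresholds: the distribution function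
  tends to 1 and so exceeds \<open>q < 1\<close> somewhere.\<close>

lemma (in prob_space) quantile_ge:
  assumes "q < 1" and events: "\<And>t. {x \<in> space M. Y x \<le> t} \<in> events"
    and less: "\<And>t. t < L \<Longrightarrow> prob {x \<in> space M. Y x \<le> t} < q"
  shows "L \<le> quantile M Y q"
  unfolding quantile_def
proof (rule cInf_greatest)
  have "(\<lambda>m. prob {x \<in> space M. Y x \<le> real m}) \<longlonglongrightarrow> prob (\<Union>m. {x \<in> space M. Y x \<le> real m})"
    using events by (intro finite_Lim_measure_incseq) (auto simp: incseq_def intro: order_trans)
  also have "(\<Union>m. {x \<in> space M. Y x \<le> real m}) = space M"
    using real_arch_simple by auto
  finally have "\<forall>\<^sub>F m in sequentially. q < prob {x \<in> space M. Y x \<le> real m}"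
    using assms(1) by (intro order_tendstoD(1)) (auto simp: prob_space)
  then obtain m :: nat where "q < prob {x \<in> space M. Y x \<le> real m}"
    using eventually_happens by fastforce
  then show "{t. q \<le> prob {x \<in> space M. Y x \<le> t}} \<noteq> {}" using less_imp_le by blast
qed (use less in \<open>force simp: not_less[symmetric]\<close>)

section \<open>The maximum defining the PoSI constant as a random variable\<close>

definition posi_max :: "real Matrix.mat \<Rightarrow> nat set set \<Rightarrow> (nat \<Rightarrow> real) \<Rightarrow> real" where
  "posi_max X \<M> \<xi> = Max {\<bar>scalar_prod (posi_w X M i) (Matrix.vec (dim_row X) \<xi>)\<bar> | M i. M \<in> \<M> \<and> i \<in> M}"

lemma posi_const_eq: "posi_const X \<M> \<alpha> = quantile (std_gaussian (dim_row X)) (posi_max X \<M>) (1 - \<alpha>)"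
  unfolding posi_const_def posi_max_def ..

lemma models_nonempty: "1 \<le> s \<Longrightarrow> 1 \<le> p \<Longrightarrow> {0} \<in> models p s"
  by (auto simp: models_def)

lemma
  assumes X: "X \<in> carrier_mat n p" and s: "1 \<le> s" and p: "1 \<le> p"
  shows posi_max_le_iff: "posi_max X (models p s) \<xi> \<le> t \<longleftrightarrow>
      (\<forall>M\<in>models p s. \<forall>i\<in>M. \<bar>\<Sum>k<n. vec_index (posi_w X M i) k * \<xi> k\<bar> \<le> t)"
    and posi_max_nonneg: "0 \<le> posi_max X (models p s) \<xi>"
proof -
  let ?h = "\<lambda>(M, i). \<bar>\<Sum>k<n. vec_index (posi_w X M i) k * \<xi> k\<bar>"
  let ?J = "SIGMA M:models p s. M"
  have J: "finite ?J" using finite_models modelsD(1) by (intro finite_SigmaI) auto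
  have ne: "({0}, 0) \<in> ?J" using models_nonempty[OF s p] by simp
  have eq: "posi_max X (models p s) \<xi> = Max (?h ` ?J)"
    unfolding posi_max_def using X
    by (intro arg_cong[where f = Max]) (force simp: scalar_prod_def atLeast0LessThan image_iff)
  show "posi_max X (models p s) \<xi> \<le> t \<longleftrightarrow>
      (\<forall>M\<in>models p s. \<forall>i\<in>M. \<bar>\<Sum>k<n. vec_index (posi_w X M i) k * \<xi> k\<bar> \<le> t)"
    unfolding eq using J ne by (subst Max_le_iff) auto
  have "?h ({0}, 0) \<le> Max (?h ` ?J)" using J ne by (intro Max_ge) auto
  then show "0 \<le> posi_max X (models p s) \<xi>" unfolding eq by simp
qed

lemma posi_max_events:
  assumes X: "X \<in> carrier_mat n p" and s: "1 \<le> s" and p: "1 \<le> p"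
  shows "{\<xi> \<in> space (std_gaussian n). posi_max X (models p s) \<xi> \<le> t} \<in> sets (std_gaussian n)"
proof -
  define J where "J = (SIGMA M:models p s. M)"
  have J: "finite J" unfolding J_def using finite_models modelsD(1) by (intro finite_SigmaI) auto
  have [measurable]: "(\<lambda>\<xi>. \<Sum>k<n. u k * \<xi> k) \<in> borel_measurable (std_gaussian n)" for u
    by (rule measurable_std_gaussian_sum) auto
  have "{\<xi> \<in> space (std_gaussian n). posi_max X (models p s) \<xi> \<le> t} =
      (\<Inter>j\<in>J. {\<xi> \<in> space (std_gaussian n). \<bar>\<Sum>k<n. vec_index (posi_w X (fst j) (snd j)) k * \<xi> k\<bar> \<le> t})"
    using posi_max_le_iff[OF X s p] models_nonempty[OF s p] by (auto simp: J_def)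
  also have "\<dots> \<in> sets (std_gaussian n)"
    using J models_nonempty[OF s p] by (intro sets.finite_INT) (auto simp: J_def)
  finally show ?thesis .
qed

lemma posi_const_nonneg:
  assumes X: "X \<in> carrier_mat n p" and s: "1 \<le> s" and p: "1 \<le> p" and \<alpha>: "0 < \<alpha>" "\<alpha> < 1"
  shows "0 \<le> posi_const X (models p s) \<alpha>"
proof -
  interpret G: prob_space "std_gaussian n" by (rule prob_space_std_gaussian)
  have "{\<xi> \<in> space (std_gaussian n). posi_max X (models p s) \<xi> \<le> t} = {}" if "t < 0" for t
    using posi_max_nonneg[OF X s p] that by (auto simp: not_le intro: less_le_trans)
  then have "G.prob {\<xi> \<in> space (std_gaussian n). posi_max X (models p s) \<xi> \<le> t} < 1 - \<alpha>"
    if "t < 0" for t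
    using that \<alpha> by (metis diff_gt_0_iff_gt measure_empty)
  then have "0 \<le> quantile (std_gaussian n) (posi_max X (models p s)) (1 - \<alpha>)"
    using \<alpha> posi_max_events[OF X s p] by (intro G.quantile_ge) auto
  then show ?thesis using X by (simp add: posi_const_eq)
qed

text \<open>Weight each model by \<open>x ^ card M\<close> with \<open>x = s / p \<le> 1\<close>: a
  model of size at most \<open>s\<close> has weight at least \<open>x ^ s\<close>, while the weights
  of all subsets add up to \<open>(1 + x) ^ p \<le> exp s\<close>.\<close>

lemma card_models_le:
  assumes "1 \<le> s" "s \<le> p"
  shows "real (card (models p s)) \<le> (exp 1 * real p / real s) ^ s"
proof -
  define x where "x = real s / real p"
  have x: "0 < x" "x \<le> 1" using assms by (auto simp: x_def)
  have "x ^ s * real (card (models p s)) = (\<Sum>M\<in>models p s. x ^ s)" by simp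
  also have "\<dots> \<le> (\<Sum>M\<in>models p s. x ^ card M)"
    using x by (intro sum_mono power_decreasing) (auto simp: models_def)
  also have "\<dots> \<le> (\<Sum>M\<in>Pow {..<p}. x ^ card M)"
    using x by (intro sum_mono2) (auto simp: models_def)
  also have "\<dots> = (\<Sum>M\<in>Pow {..<p}. (\<Prod>i\<in>M. x) * (\<Prod>i\<in>{..<p} - M. 1))" by simp
  also have "\<dots> = (\<Prod>i<p. x + 1)" by (rule prod_add[symmetric]) simp
  also have "\<dots> \<le> exp x ^ p" using x by (simp add: power_mono add.commute)
  also have "\<dots> = exp 1 ^ s" using assms by (simp add: exp_of_nat_mult[symmetric] x_def)
  finally have "real (card (models p s)) \<le> exp 1 ^ s / x ^ s" using x by (simp add: field_simps)
  then show ?thesis using assms by (simp add: x_def power_divide power_mult_distrib field_simps)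
qed

lemma card_model_pairs_le:
  assumes "1 \<le> s" "s \<le> p"
  shows "real (card (SIGMA M:models p s. M)) \<le> real s * (exp 1 * real p / real s) ^ s"
proof -
  have "card (SIGMA M:models p s. M) = (\<Sum>M\<in>models p s. card M)"
    using modelsD(1) by (intro card_SigmaI finite_models) auto
  also have "real \<dots> \<le> (\<Sum>M\<in>models p s. real s)"
    unfolding of_nat_sum using modelsD(4) by (intro sum_mono) fastforce
  also have "\<dots> \<le> real s * (exp 1 * real p / real s) ^ s"
    using card_models_le[OF assms] by (simp add: mult_left_mono mult.commute)
  finally show ?thesis .
qed

text \<open>Two exceptional events have probability at most \<open>\<alpha> / 2\<close> each: one of
  the \<open>p\<close> normalized columns exceeds \<open>t1\<close>, or one of the remainders
  \<open>z\<close> exceeds \<open>t2\<close>. Outside them \<open>posi_w_perturbation\<close> bounds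
  the maximum by \<open>t1 + t2\<close>. The number of pairs enters through an upper bound
  \<open>N\<close> so that an explicit estimate can be inserted.\<close>

lemma posi_const_upper:
  assumes X: "X \<in> carrier_mat n p" and s: "1 \<le> s" "s \<le> p" and rip: "rip_delta X s \<le> d"
    and d: "0 < d" "d \<le> 1/2" and \<alpha>: "0 < \<alpha>" "\<alpha> < 1"
    and N: "real (card (SIGMA M:models p s. M)) \<le> N" "1 \<le> N"
  shows "posi_const X (models p s) \<alpha> \<le> sqrt (2 * ln (4 * real p / \<alpha>)) + 2 * d * sqrt (2 * ln (4 * N / \<alpha>))"
proof -
  interpret G: prob_space "std_gaussian n" by (rule prob_space_std_gaussian)
  define J where "J = (SIGMA M:models p s. M)"
  have J: "finite J" unfolding J_def using finite_models modelsD(1) by (intro finite_SigmaI) auto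
  have "\<exists>\<tau> z. \<forall>(M, i)\<in>J. \<bar>\<tau> (M, i)\<bar> \<le> 1 \<and> (\<Sum>k<n. (z (M, i) k)\<^sup>2) \<le> (2 * d)\<^sup>2 \<and>
     (\<forall>k<n. vec_index (posi_w X M i) k = \<tau> (M, i) * unit_col X k i + z (M, i) k)"
  proof -
    have "\<forall>j\<in>J. \<exists>tz. \<bar>fst tz\<bar> \<le> 1 \<and> (\<Sum>k<n. (snd tz k)\<^sup>2) \<le> (2 * d)\<^sup>2 \<and>
       (\<forall>k<n. vec_index (posi_w X (fst j) (snd j)) k = fst tz * unit_col X k (snd j) + snd tz k)"
    proof
      fix j assume "j \<in> J"
      then have "fst j \<in> models p s" "snd j \<in> fst j" by (auto simp: J_def)
      from posi_w_perturbation[OF X this(1) rip d(2) this(2)]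
      show "\<exists>tz. \<bar>fst tz\<bar> \<le> 1 \<and> (\<Sum>k<n. (snd tz k)\<^sup>2) \<le> (2 * d)\<^sup>2 \<and>
       (\<forall>k<n. vec_index (posi_w X (fst j) (snd j)) k = fst tz * unit_col X k (snd j) + snd tz k)"
        by (metis fst_conv snd_conv)
    qed
    from bchoice[OF this] obtain h where "\<forall>j\<in>J. \<bar>fst (h j)\<bar> \<le> 1 \<and> (\<Sum>k<n. (snd (h j) k)\<^sup>2) \<le> (2 * d)\<^sup>2 \<and>
       (\<forall>k<n. vec_index (posi_w X (fst j) (snd j)) k = fst (h j) * unit_col X k (snd j) + snd (h j) k)" ..
    then show ?thesis by (intro exI[of _ "fst \<circ> h"] exI[of _ "snd \<circ> h"]) auto
  qed
  then obtain \<tau> z where \<tau>: "\<And>M i. (M, i) \<in> J \<Longrightarrow> \<bar>\<tau> (M, i)\<bar> \<le> 1"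
    and z: "\<And>M i. (M, i) \<in> J \<Longrightarrow> (\<Sum>k<n. (z (M, i) k)\<^sup>2) \<le> (2 * d)\<^sup>2"
    and w: "\<And>M i k. (M, i) \<in> J \<Longrightarrow> k < n \<Longrightarrow> vec_index (posi_w X M i) k = \<tau> (M, i) * unit_col X k i + z (M, i) k"
    by fast
  define t1 t2 where "t1 = 1 * sqrt (2 * ln (2 * real p / (\<alpha> / 2)))" and "t2 = (2 * d) * sqrt (2 * ln (2 * N / (\<alpha> / 2)))"
  define B1 B2 where "B1 = {\<xi> \<in> space (std_gaussian n). \<exists>i\<in>{..<p}. t1 \<le> \<bar>\<Sum>k<n. unit_col X k i * \<xi> k\<bar>}"
    and "B2 = {\<xi> \<in> space (std_gaussian n). \<exists>j\<in>J. t2 \<le> \<bar>\<Sum>k<n. z j k * \<xi> k\<bar>}"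
  define C where "C = {\<xi> \<in> space (std_gaussian n). posi_max X (models p s) \<xi> \<le> t1 + t2}"
  have meas [measurable]: "(\<lambda>\<xi>. \<Sum>k<n. u k * \<xi> k) \<in> borel_measurable (std_gaussian n)" for u
    by (rule measurable_std_gaussian_sum) auto
  have B: "B1 \<in> G.events" "B2 \<in> G.events" unfolding B1_def B2_def using J by measurable
  have C: "C \<in> G.events"
    unfolding C_def using s by (intro posi_max_events[OF X]) auto
  have "G.prob B1 \<le> \<alpha> / 2" unfolding B1_def t1_def
    using sum_unit_col_power2_le[OF X] s \<alpha>
    by (intro std_gaussian_max_tail[where u = "\<lambda>i k. unit_col X k i"]) auto
  moreover have "G.prob B2 \<le> \<alpha> / 2" unfolding B2_def t2_def
    using z d N \<alpha> J by (intro std_gaussian_max_tail) (auto simp: J_def)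
  moreover have "G.prob (space (std_gaussian n) - C) \<le> G.prob (B1 \<union> B2)"
  proof (rule G.finite_measure_mono)
    show "space (std_gaussian n) - C \<subseteq> B1 \<union> B2"
    proof
      fix \<xi> assume \<xi>: "\<xi> \<in> space (std_gaussian n) - C"
      then obtain M i where Mi: "(M, i) \<in> J" and gt: "t1 + t2 < \<bar>\<Sum>k<n. vec_index (posi_w X M i) k * \<xi> k\<bar>"
        using posi_max_le_iff[OF X s(1), of \<xi> "t1 + t2"] s by (auto simp: C_def J_def not_le)
      have "(\<Sum>k<n. vec_index (posi_w X M i) k * \<xi> k) = \<tau> (M, i) * (\<Sum>k<n. unit_col X k i * \<xi> k) + (\<Sum>k<n. z (M, i) k * \<xi> k)"
        using w[OF Mi] by (simp add: sum_distrib_left sum.distrib[symmetric] algebra_simps)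
      moreover have "\<bar>\<tau> (M, i) * (\<Sum>k<n. unit_col X k i * \<xi> k)\<bar> \<le> 1 * \<bar>\<Sum>k<n. unit_col X k i * \<xi> k\<bar>"
        unfolding abs_mult using \<tau>[OF Mi] by (intro mult_right_mono) auto
      ultimately have "t1 \<le> \<bar>\<Sum>k<n. unit_col X k i * \<xi> k\<bar> \<or> t2 \<le> \<bar>\<Sum>k<n. z (M, i) k * \<xi> k\<bar>"
        using gt by linarith
      moreover have "i < p" using Mi modelsD(2) by (auto simp: J_def)
      ultimately show "\<xi> \<in> B1 \<union> B2" using \<xi> Mi by (auto simp: B1_def B2_def)
    qed
  qed (use B in auto)
  moreover have "G.prob (B1 \<union> B2) \<le> G.prob B1 + G.prob B2" using B by (rule measure_Un_le)
  ultimately have "1 - \<alpha> \<le> G.prob C" using G.prob_compl[OF C] by linarith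
  then have "quantile (std_gaussian n) (posi_max X (models p s)) (1 - \<alpha>) \<le> t1 + t2"
    using \<alpha> posi_max_nonneg[OF X s(1)] s unfolding C_def by (intro G.quantile_le) auto
  then show ?thesis using X by (simp add: posi_const_eq t1_def t2_def mult.commute)
qed

subsection \<open>A design attaining the lower bound\<close>

text \<open>If \<open>k * a^2 \<le> 1\<close>, the bottom entry of the last column completes it to a
  unit vector. For \<open>k \<le> p - 1\<close> the Gram matrix then differs from the identity only
  by entries \<open>a\<close> that join the last column to the first \<open>k\<close>.\<close>

definition spike_design :: "nat \<Rightarrow> nat \<Rightarrow> real \<Rightarrow> real Matrix.mat" where
  "spike_design p k a = Matrix.mat p p (\<lambda>(r, c).
     if c < p - 1 then of_bool (r = c) else if r < k then a
     else if r = p - 1 then sqrt (1 - real k * a\<^sup>2) else 0)"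

context
  fixes p k :: nat and a :: real and X :: "real Matrix.mat"
  assumes p: "2 \<le> p" and k: "k \<le> p - 1" and ka: "real k * a\<^sup>2 \<le> 1"
  defines "X \<equiv> spike_design p k a"
begin

lemma spike_carrier: "X \<in> carrier_mat p p"
  by (simp add: X_def spike_design_def)

lemma spike_index_basis: "r < p \<Longrightarrow> c < p - 1 \<Longrightarrow> X $$ (r, c) = of_bool (r = c)"
  by (simp add: X_def spike_design_def)

lemma spike_index_last:
  "r < p \<Longrightarrow> c = p - 1 \<Longrightarrow> X $$ (r, c) = (if r < k then a else if r = p - 1 then sqrt (1 - real k * a\<^sup>2) else 0)"
  using p by (simp add: X_def spike_design_def)

lemma spike_sum_basis: "c < p - 1 \<Longrightarrow> (\<Sum>r<p. X $$ (r, c) * h r) = h c"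
proof -
  assume c: "c < p - 1"
  have "(\<Sum>r<p. X $$ (r, c) * h r) = (\<Sum>r<p. if r = c then h r else 0)"
    using c by (intro sum.cong refl) (simp add: spike_index_basis)
  then show ?thesis using c by simp
qed

lemma spike_last_norm: "(\<Sum>r<p. (X $$ (r, p - 1))\<^sup>2) = 1"
proof -
  have "(\<Sum>r<p. (X $$ (r, p - 1))\<^sup>2) = (\<Sum>r<p. (if r < k then a\<^sup>2 else 0) + (if r = p - 1 then 1 - real k * a\<^sup>2 else 0))"
    using k ka by (intro sum.cong refl) (auto simp: spike_index_last)
  also have "\<dots> = (\<Sum>r<p. if r < k then a\<^sup>2 else 0) + (1 - real k * a\<^sup>2)"
    using p by (simp add: sum.distrib)
  also have "(\<Sum>r<p. if r < k then a\<^sup>2 else 0) = (\<Sum>r<k. a\<^sup>2)"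
    using k by (intro sum.mono_neutral_cong_right) auto
  finally show ?thesis by simp
qed

lemma spike_colprod:
  assumes "i < p" "j < p"
  shows "colprod X i j = of_bool (i = j) + (if i = p - 1 \<and> j < k \<or> j = p - 1 \<and> i < k then a else 0)"
proof -
  have dim: "dim_row X = p" using spike_carrier by simp
  consider "i < p - 1" | "j < p - 1" "i = p - 1" | "i = p - 1" "j = p - 1" using assms p by linarith
  then show ?thesis
  proof cases
    case 1
    then have "colprod X i j = X $$ (i, j)"
      unfolding colprod_def dim by (rule spike_sum_basis)
    then show ?thesis
      using 1 assms k
      by (cases "j < p - 1") (auto simp: spike_index_basis spike_index_last linorder_neq_iff)
  next
    case 2
    then have "colprod X i j = X $$ (j, i)"
      unfolding colprod_def dim by (subst mult.commute) (rule spike_sum_basis)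
    then show ?thesis using 2 assms k by (auto simp: spike_index_last)
  next
    case 3
    then show ?thesis using spike_last_norm k p
      by (simp add: colprod_def dim power2_eq_square)
  qed
qed

lemma spike_colcorr:
  assumes "i < p" "j < p"
  shows "colcorr X i j - of_bool (i = j) = (if i = p - 1 \<and> j < k \<or> j = p - 1 \<and> i < k then a else 0)"
  using assms k p by (simp add: colcorr_def spike_colprod)

text \<open>Minus the identity, the correlation matrix of a model is a star joining the last column
  to at most \<open>s\<close> others with entries \<open>a\<close>; its operator norm is at most
  \<open>\<bar>a\<bar> * sqrt s\<close>.\<close>

lemma spike_rip:
  assumes s: "1 \<le> s" and d: "0 \<le> d" and a: "real s * a\<^sup>2 \<le> d\<^sup>2"
  shows "rip_delta X s \<le> d"
proof (rule rip_delta_le[OF spike_carrier _ d])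
  show "models p s \<noteq> {}" using models_nonempty[OF s, of p] p by auto
next
  fix M and g :: "nat \<Rightarrow> real" assume M: "M \<in> models p s"
  note M' = modelsD[OF M]
  define l M0 where "l = p - 1" and "M0 = M - {l}"
  define h where "h j = (if j < k then a else 0)" for j
  have fin: "finite M0" using M' by (simp add: M0_def)
  \<comment> \<open>Row \<open>l\<close> pairs \<open>g\<close> with \<open>h\<close> on the rest of
    the model; any other row sees only the entry \<open>g l\<close>.\<close>
  have row: "(\<Sum>j\<in>M. (colcorr X i j - of_bool (i = j)) * g j) =
      (if i = l then \<Sum>j\<in>M0. h j * g j else if l \<in> M then h i * g l else 0)" if i: "i \<in> M" for i
  proof -
    have "(\<Sum>j\<in>M. (colcorr X i j - of_bool (i = j)) * g j)
      = (\<Sum>j\<in>M. if i = l then h j * g j else if j = l then h i * g j else 0)"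
      using i M' k by (intro sum.cong refl) (subst spike_colcorr, auto simp: l_def h_def)
    also have "\<dots> = (if i = l then \<Sum>j\<in>M. h j * g j else if l \<in> M then h i * g l else 0)"
      using M' by simp
    also have "(\<Sum>j\<in>M. h j * g j) = (\<Sum>j\<in>M0. h j * g j)"
      using M' k by (intro sum.mono_neutral_right) (auto simp: M0_def h_def l_def)
    finally show ?thesis .
  qed
  have "(\<Sum>j\<in>M0. (h j)\<^sup>2) \<le> (\<Sum>j\<in>M0. a\<^sup>2)" by (intro sum_mono) (auto simp: h_def)
  also have "\<dots> \<le> real s * a\<^sup>2"
    using M' card_mono[OF M'(1), of M0] by (auto simp: M0_def intro!: mult_right_mono)
  finally have h: "(\<Sum>j\<in>M0. (h j)\<^sup>2) \<le> d\<^sup>2" using a by simp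
  have "(\<Sum>i\<in>M. (\<Sum>j\<in>M. (colcorr X i j - of_bool (i = j)) * g j)\<^sup>2)
     = (\<Sum>i\<in>M. (if i = l then \<Sum>j\<in>M0. h j * g j else if l \<in> M then h i * g l else 0)\<^sup>2)"
    by (intro sum.cong refl) (simp only: row)
  also have "\<dots> \<le> d\<^sup>2 * (\<Sum>i\<in>M. (g i)\<^sup>2)"
  proof (cases "l \<in> M")
    case True
    have "(\<Sum>i\<in>M. (if i = l then \<Sum>j\<in>M0. h j * g j else if l \<in> M then h i * g l else 0)\<^sup>2)
      = (\<Sum>j\<in>M0. h j * g j)\<^sup>2 + (\<Sum>i\<in>M0. (h i * g l)\<^sup>2)"
      using True M' unfolding M0_def by (subst sum.remove[of _ l]) (auto intro!: sum.cong)
    also have "(\<Sum>i\<in>M0. (h i * g l)\<^sup>2) = (\<Sum>i\<in>M0. (h i)\<^sup>2) * (g l)\<^sup>2"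
      by (simp add: power_mult_distrib sum_distrib_right)
    also have "\<dots> \<le> d\<^sup>2 * (g l)\<^sup>2" using h by (intro mult_right_mono) auto
    also have "(\<Sum>j\<in>M0. h j * g j)\<^sup>2 \<le> (\<Sum>j\<in>M0. (h j)\<^sup>2) * (\<Sum>j\<in>M0. (g j)\<^sup>2)"
      by (rule Cauchy_Schwarz_ineq_sum)
    also have "\<dots> \<le> d\<^sup>2 * (\<Sum>j\<in>M0. (g j)\<^sup>2)" using h by (intro mult_right_mono sum_nonneg) auto
    also have "d\<^sup>2 * (\<Sum>j\<in>M0. (g j)\<^sup>2) + d\<^sup>2 * (g l)\<^sup>2 = d\<^sup>2 * (\<Sum>i\<in>M. (g i)\<^sup>2)"
      using True M' unfolding M0_def by (subst (2) sum.remove[of _ l]) (auto simp: algebra_simps)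
    finally show ?thesis by simp
  next
    case False
    then have "(\<Sum>i\<in>M. (if i = l then \<Sum>j\<in>M0. h j * g j else if l \<in> M then h i * g l else 0)\<^sup>2) = 0"
      by (intro sum.neutral) auto
    then show ?thesis by (simp add: sum_nonneg)
  qed
  finally have "L2_set (\<lambda>i. \<Sum>j\<in>M. (colcorr X i j - of_bool (i = j)) * g j) M \<le> sqrt (d\<^sup>2 * (\<Sum>i\<in>M. (g i)\<^sup>2))"
    unfolding L2_set_def by (rule real_sqrt_le_mono)
  then show "L2_set (\<lambda>i. \<Sum>j\<in>M. (colcorr X i j - of_bool (i = j)) * g j) M \<le> d * L2_set g M"
    using d by (simp add: L2_set_def real_sqrt_mult)
qed

text \<open>The other columns of the model are basis vectors, so the residual of the last column
  arises by deleting its coordinates in \<open>M\<close>. Deletion cannot raise the norm above 1,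
  hence the normalizing factor \<open>c\<close> is at least 1. The condition
  \<open>card M < s\<close> leaves a place for the last column.\<close>

lemma spike_posi_w:
  assumes M: "M \<subseteq> {..<k}" and rip: "rip_delta X s \<le> d" "d < 1" and card: "card M < s"
  obtains c where "1 \<le> c"
    and "\<And>r. r < p \<Longrightarrow> vec_index (posi_w X (insert (p - 1) M) (p - 1)) r = c * (X $$ (r, p - 1) - (if r \<in> M then a else 0))"
proof -
  define l M' where "l = p - 1" and "M' = insert l M"
  have fin: "finite M" using M finite_subset by blast
  have lM: "l \<notin> M" using M k by (auto simp: l_def)
  have M'_model: "M' \<in> models p s"
    using M k p card fin lM by (auto simp: models_def M'_def l_def)
  have M'_le: "M' \<subseteq> {..<p}" using modelsD[OF M'_model] by simp
  obtain c where vc: "posi_v X M' l \<in> carrier_vec p"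
    and vk: "\<And>r. r < p \<Longrightarrow> vec_index (posi_v X M' l) r = (\<Sum>j\<in>M'. c j * X $$ (r, j))"
    and vX: "\<And>j. j \<in> M' \<Longrightarrow> (\<Sum>r<p. X $$ (r, j) * vec_index (posi_v X M' l) r) = of_bool (j = l)"
    using posi_v_characterization[OF spike_carrier M'_le _ rip_injective[OF spike_carrier M'_model rip], of l]
    by (auto simp: M'_def)
  define v where "v r = vec_index (posi_v X M' l) r" for r
  define y where "y r = X $$ (r, l) - (if r \<in> M then a else 0)" for r
  define \<rho> where "\<rho> = (\<Sum>r<p. (y r)\<^sup>2)"
  have yX: "X $$ (r, l) * y r = (y r)\<^sup>2" if "r < p" for r
    using M that by (auto simp: y_def l_def spike_index_last power2_eq_square)
  \<comment> \<open>In rows of \<open>M\<close> the vector vanishes by orthogonality to the basis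
    columns; in other rows only the last column contributes.\<close>
  have v: "v r = c l * y r" if r: "r < p" for r
  proof (cases "r \<in> M")
    case True
    then have "r < p - 1" using M k by auto
    then have "v r = (\<Sum>q<p. X $$ (q, r) * v q)" by (simp add: spike_sum_basis)
    also have "\<dots> = 0" using vX[of r] True lM by (auto simp: M'_def v_def)
    finally show ?thesis using True M r by (auto simp: y_def l_def spike_index_last)
  next
    case False
    have "v r = (\<Sum>j\<in>M'. c j * X $$ (r, j))" using vk[OF r] by (simp add: v_def)
    also have "\<dots> = c l * X $$ (r, l) + (\<Sum>j\<in>M. c j * X $$ (r, j))"
      using fin lM by (simp add: M'_def)
    also have "(\<Sum>j\<in>M. c j * X $$ (r, j)) = 0"
      using False M k r by (intro sum.neutral) (auto simp: subset_iff spike_index_basis)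
    finally show ?thesis using False by (simp add: y_def)
  qed
  have "1 = (\<Sum>r<p. X $$ (r, l) * v r)" using vX[of l] by (simp add: M'_def v_def)
  also have "\<dots> = (\<Sum>r<p. c l * (y r)\<^sup>2)"
    using v yX by (intro sum.cong refl) (simp add: mult.left_commute)
  also have "\<dots> = c l * \<rho>" by (simp add: \<rho>_def sum_distrib_left)
  finally have c\<rho>: "c l * \<rho> = 1" by simp
  then have "\<rho> \<noteq> 0" by auto
  then have \<rho>: "\<rho> > 0" by (simp add: \<rho>_def sum_nonneg less_le)
  have "c l = 1 / \<rho>" using c\<rho> \<rho> by (simp add: field_simps)
  then have c0: "c l > 0" using \<rho> by simp
  have "\<rho> \<le> (\<Sum>r<p. (X $$ (r, l))\<^sup>2)" unfolding \<rho>_def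
    using M by (intro sum_mono) (auto simp: y_def l_def spike_index_last subset_iff)
  then have \<rho>1: "\<rho> \<le> 1" using spike_last_norm by (simp add: l_def)
  have "vnorm (posi_v X M' l) = L2_set (\<lambda>r. c l * y r) {..<p}"
    using vc v by (auto simp: vnorm_eq_L2_set v_def intro!: L2_set_cong)
  also have "\<dots> = c l * sqrt \<rho>" using c0 by (simp add: L2_set_scale L2_set_def \<rho>_def)
  finally have vn: "vnorm (posi_v X M' l) = c l * sqrt \<rho>" .
  then have "posi_v X M' l \<noteq> 0\<^sub>v p" using c0 \<rho> by (auto simp: vnorm_def)
  then have "vec_index (posi_w X M' l) r = 1 / sqrt \<rho> * y r" if "r < p" for r
    using that spike_carrier vc c0 v[OF that] by (simp add: posi_w_def vn v_def)
  moreover have "1 \<le> 1 / sqrt \<rho>" using \<rho> \<rho>1 by simp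
  ultimately show ?thesis using that by (simp add: y_def l_def M'_def)
qed

text \<open>The factor \<open>c \<ge> 1\<close> only increases the absolute value and is dropped.
  The estimate is pointwise in \<open>\<xi>\<close>, so \<open>M\<close> may be selected depending
  on \<open>\<xi>\<close>.\<close>

lemma spike_posi_max_ge:
  assumes M: "M \<subseteq> {..<k}" and rip: "rip_delta X s \<le> d" "d < 1" and card: "card M < s"
  shows "a * (\<Sum>j\<in>M. \<xi> j) - \<bar>\<Sum>r<p. X $$ (r, p - 1) * \<xi> r\<bar> \<le> posi_max X (models p s) \<xi>"
proof -
  have fin: "finite M" using M finite_subset by blast
  obtain c where c: "1 \<le> c"
    and w: "\<And>r. r < p \<Longrightarrow> vec_index (posi_w X (insert (p - 1) M) (p - 1)) r = c * (X $$ (r, p - 1) - (if r \<in> M then a else 0))"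
    using spike_posi_w[OF assms] by blast
  define S where "S = (\<Sum>r<p. X $$ (r, p - 1) * \<xi> r) - a * (\<Sum>j\<in>M. \<xi> j)"
  have "(\<Sum>r<p. (if r \<in> M then a else 0) * \<xi> r) = (\<Sum>r\<in>M. a * \<xi> r)"
    using M k by (intro sum.mono_neutral_cong_right) auto
  then have "(\<Sum>r<p. (X $$ (r, p - 1) - (if r \<in> M then a else 0)) * \<xi> r) = S"
    by (simp add: S_def left_diff_distrib sum_subtractf sum_distrib_left)
  then have "(\<Sum>r<p. vec_index (posi_w X (insert (p - 1) M) (p - 1)) r * \<xi> r) = c * S"
    using w by (simp add: sum_distrib_left[symmetric] mult.assoc)
  moreover have "insert (p - 1) M \<in> models p s"
    using M k p card fin by (auto simp: models_def card_insert_if)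
  moreover have "\<forall>M\<in>models p s. \<forall>i\<in>M.
      \<bar>\<Sum>r<p. vec_index (posi_w X M i) r * \<xi> r\<bar> \<le> posi_max X (models p s) \<xi>"
    using card p by (subst posi_max_le_iff[OF spike_carrier, symmetric]) auto
  ultimately have "\<bar>c * S\<bar> \<le> posi_max X (models p s) \<xi>" by force
  moreover have "1 * \<bar>S\<bar> \<le> \<bar>c * S\<bar>" unfolding abs_mult using c by (intro mult_right_mono) auto
  moreover have "a * (\<Sum>j\<in>M. \<xi> j) - \<bar>\<Sum>r<p. X $$ (r, p - 1) * \<xi> r\<bar> \<le> \<bar>S\<bar>"
    unfolding S_def by linarith
  ultimately show ?thesis by linarith
qed

text \<open>The bad events are too few of the \<open>k\<close> coordinates above \<open>T\<close>,
  and a large product of the last column with \<open>\<xi>\<close>. Each has probability at most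
  \<open>(1 - \<alpha>) / 4\<close>, so together they stay below \<open>1 - \<alpha>\<close>.
  Otherwise \<open>M\<close> collects coordinates above \<open>T\<close>.\<close>

lemma spike_posi_const_ge:
  assumes a: "0 \<le> a" and s: "1 \<le> s" and rip: "rip_delta X s \<le> d" "d < 1"
    and \<alpha>: "0 < \<alpha>" "\<alpha> < 1" and T: "0 \<le> T"
    and small: "exp (- (real k * measure std_normal {T..} / 10)) \<le> (1 - \<alpha>) / 4"
  shows "a * (T * min (real s - 1) (real k * measure std_normal {T..} / 2)) - sqrt (2 * ln (8 / (1 - \<alpha>)))
    \<le> posi_const X (models p s) \<alpha>"
proof -
  interpret G: prob_space "std_gaussian p" by (rule prob_space_std_gaussian)
  define b where "b = real k * measure std_normal {T..} / 2"
  define C where "C = 1 * sqrt (2 * ln (2 * 1 / ((1 - \<alpha>) / 4)))"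
  define D where "D = a * (T * min (real s - 1) b) - C"
  let ?N = "\<lambda>\<xi>. real (card {j. j < k \<and> T \<le> \<xi> j})"
  define E1 E2 where "E1 = {\<xi> \<in> space (std_gaussian p). ?N \<xi> \<le> b}"
    and "E2 = {\<xi> \<in> space (std_gaussian p). \<exists>j\<in>{p - 1}. C \<le> \<bar>\<Sum>r<p. X $$ (r, j) * \<xi> r\<bar>}"
  have "(\<lambda>\<xi>. \<Sum>j<k. indicator {T..} (\<xi> j) :: real) \<in> borel_measurable (std_gaussian p)"
    using k by (intro borel_measurable_sum measurable_std_gaussian_component[where f = "indicator {T..}"]) auto
  then have E1: "E1 \<in> G.events" unfolding E1_def real_card_upper_eq_sum by measurable
  have "(\<lambda>\<xi>. \<Sum>r<p. X $$ (r, j) * \<xi> r) \<in> borel_measurable (std_gaussian p)" for j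
    by (rule measurable_std_gaussian_sum) auto
  then have E2: "E2 \<in> G.events" unfolding E2_def by measurable
  have "G.prob E1 \<le> exp (- (real k * measure std_normal {T..} / 10))"
    unfolding E1_def b_def using k by (intro std_gaussian_count_lower_tail) auto
  moreover have "G.prob E2 \<le> (1 - \<alpha>) / 4" unfolding E2_def C_def
    using spike_last_norm \<alpha> by (intro std_gaussian_max_tail[where u = "\<lambda>j r. X $$ (r, j)"]) auto
  moreover have "G.prob (E1 \<union> E2) \<le> G.prob E1 + G.prob E2" using E1 E2 by (rule measure_Un_le)
  ultimately have PE: "G.prob (E1 \<union> E2) < 1 - \<alpha>" using small \<alpha> by argo
  have "G.prob {\<xi> \<in> space (std_gaussian p). posi_max X (models p s) \<xi> \<le> t} < 1 - \<alpha>" if t: "t < D" for t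
  proof -
    have "{\<xi> \<in> space (std_gaussian p). posi_max X (models p s) \<xi> \<le> t} \<subseteq> E1 \<union> E2"
    proof (rule ccontr)
      assume "\<not> ?thesis"
      then obtain \<xi> where \<xi>': "\<xi> \<in> space (std_gaussian p)" "posi_max X (models p s) \<xi> \<le> t"
          "\<xi> \<notin> E1" "\<xi> \<notin> E2"
        by blast
      then have \<xi>: "posi_max X (models p s) \<xi> \<le> t" "b < ?N \<xi>" "\<bar>\<Sum>r<p. X $$ (r, p - 1) * \<xi> r\<bar> < C"
        by (simp_all add: E1_def E2_def not_le)
      \<comment> \<open>At most \<open>s - 1\<close> indices are taken because the last column
        occupies one place of the model.\<close>
      obtain M where M: "M \<subseteq> {j. j < k \<and> T \<le> \<xi> j}" "card M = min (s - 1) (card {j. j < k \<and> T \<le> \<xi> j})"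
        using ex_card[OF min.cobounded2[of "s - 1" "card {j. j < k \<and> T \<le> \<xi> j}"]]
        by (elim exE conjE) (rule that)
      have "min (real s - 1) b \<le> real (card M)"
      proof (cases "card M = s - 1")
        case True
        then have "real (card M) = real s - 1" using s by (simp add: of_nat_diff)
        then show ?thesis by simp
      next
        case False
        then have "card M = card {j. j < k \<and> T \<le> \<xi> j}" using M(2) by (metis min_def)
        then show ?thesis using \<xi>(2) by (simp only: min.coboundedI2 less_imp_le)
      qed
      then have "T * min (real s - 1) b \<le> T * real (card M)" using T by (rule mult_left_mono)
      also have "\<dots> = (\<Sum>j\<in>M. T)" by simp
      also have "\<dots> \<le> (\<Sum>j\<in>M. \<xi> j)" using M(1) by (intro sum_mono) auto
      finally have "a * (T * min (real s - 1) b) \<le> a * (\<Sum>j\<in>M. \<xi> j)" using a by (rule mult_left_mono)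
      moreover have "a * (\<Sum>j\<in>M. \<xi> j) - \<bar>\<Sum>r<p. X $$ (r, p - 1) * \<xi> r\<bar> \<le> posi_max X (models p s) \<xi>"
        using M s by (intro spike_posi_max_ge[OF _ rip]) auto
      ultimately show False using \<xi> t by (simp add: D_def)
    qed
    then have "G.prob {\<xi> \<in> space (std_gaussian p). posi_max X (models p s) \<xi> \<le> t} \<le> G.prob (E1 \<union> E2)"
      using E1 E2 by (intro G.finite_measure_mono) auto
    then show ?thesis using PE by simp
  qed
  then have "D \<le> quantile (std_gaussian p) (posi_max X (models p s)) (1 - \<alpha>)"
    using \<alpha> p s by (intro G.quantile_ge posi_max_events[OF spike_carrier]) auto
  then show ?thesis using spike_carrier by (simp add: posi_const_eq D_def C_def b_def)
qed

end

subsection \<open>Rates\<close>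

lemma one_le_ln: "3 \<le> x \<Longrightarrow> 1 \<le> ln x" for x :: real
  using exp_le by (subst ln_ge_iff) auto

text \<open>Both terms of \<open>posi_const_upper\<close> are brought to the scale of
  \<open>s\<close>: the first by \<open>dom\<close>, the second because \<open>ln N\<close> is of
  order \<open>t * ln (6 * p / t)\<close>, which increases with \<open>t\<close> up to
  \<open>s\<close>.\<close>

lemma posi_const_upper_rate:
  assumes X: "X \<in> carrier_mat n p" and t: "1 \<le> t" "t \<le> s" "s < p" and rip: "rip_delta X t \<le> d"
    and d: "0 < d" "d \<le> 1/2" and \<alpha>: "0 < \<alpha>" "\<alpha> < 1" and p: "3 \<le> p"
    and dom: "sqrt (ln p) \<le> d * sqrt s * sqrt (ln (6 * real p / real s))"
  shows "posi_const X (models p t) \<alpha> \<le>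
    (sqrt (2 * (ln (4 / \<alpha>) + 1)) + 2 * sqrt (2 * (ln (4 / \<alpha>) + 2))) * d * sqrt s * sqrt (ln (6 * real p / real s))"
proof -
  define c where "c = ln (4 / \<alpha>)"
  define l where "l x = ln (6 * real p / x)" for x
  define N where "N = real t * (exp 1 * real p / real t) ^ t"
  have c: "c \<ge> 0" using \<alpha> by (simp add: c_def)
  have lnp: "ln (real p) \<ge> 1" using p by (intro one_le_ln) auto
  have l6: "ln 6 \<ge> (1::real)" by (rule one_le_ln) simp
  have l_eq: "l x = ln 6 + ln (real p / x)" if "x > 0" for x
    using ln_mult[of 6 "real p / x"] that p by (simp add: l_def)
  have lt: "1 + ln (real p / real t) \<le> l t" using l_eq[of t] l6 t by simp
  have lt1: "1 \<le> l t"
  proof -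
    have "0 \<le> ln (real p / real t)" using t by (intro ln_ge_zero) auto
    then show ?thesis using lt by linarith
  qed
  have ls: "1 \<le> l s"
  proof -
    have "0 \<le> ln (real p / real s)" using t by (intro ln_ge_zero) auto
    moreover have "l s = ln 6 + ln (real p / real s)" using t by (intro l_eq) simp
    ultimately show ?thesis using l6 by linarith
  qed
  \<comment> \<open>Monotonicity rests on \<open>t * l t = t * l s + t * ln (s / t)\<close>, whose
    last summand is at most \<open>s - t\<close>, hence at most \<open>(s - t) * l s\<close> as
    \<open>l s \<ge> 1\<close>.\<close>
  have "ln (real s / real t) \<le> real s / real t - 1" using t by (intro ln_le_minus_one) auto
  then have "real t * ln (real s / real t) \<le> real s - real t" using t by (simp add: field_simps)
  also have "\<dots> \<le> (real s - real t) * l s" using ls t by (simp add: mult_le_cancel_left1)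
  finally have mono: "real t * l t \<le> real s * l s"
    using t p by (simp add: l_def ln_div algebra_simps)
  have e: "1 \<le> exp 1 * real p / real t"
  proof -
    have "real t \<le> 1 * real p" using t by simp
    also have "\<dots> \<le> exp 1 * real p" by (intro mult_right_mono) auto
    finally show ?thesis using t by simp
  qed
  have N1: "N \<ge> 1" unfolding N_def using t one_le_power[OF e, of t]
    mult_mono[of 1 "real t" 1 "(exp 1 * real p / real t) ^ t"] by simp
  have "ln (4 * N / \<alpha>) = c + ln N"
    using \<alpha> N1 ln_mult[of "4 / \<alpha>" N] by (simp add: c_def)
  moreover have "ln N = ln t + t * (1 + ln (real p / real t))"
  proof -
    have "ln (exp 1 * (real p / real t)) = 1 + ln (real p / real t)"
      using t p by (subst ln_mult) auto
    then show ?thesis unfolding N_def using t p by (subst ln_mult) (auto simp: ln_realpow)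
  qed
  moreover have "ln (real t) \<le> real t" using t ln_le_minus_one[of "real t"] by simp
  moreover have "real t \<le> real t * l t" using lt1 t by (simp add: mult_le_cancel_left1)
  moreover have "real t * (1 + ln (real p / real t)) \<le> real t * l t" using lt by (intro mult_left_mono) auto
  moreover have "c \<le> c * (real s * l s)"
    using c ls t mult_mono[of 1 "real s" 1 "l s"] by (simp add: mult_le_cancel_left1)
  moreover have "(c + 2) * (real s * l s) = c * (real s * l s) + 2 * (real s * l s)"
    by (rule distrib_right)
  ultimately have lnN: "ln (4 * N / \<alpha>) \<le> (c + 2) * (real s * l s)" using mono by linarith
  have "ln (4 * real p / \<alpha>) = c + ln p"
    using \<alpha> p ln_mult[of "4 / \<alpha>" "real p"] by (simp add: c_def)
  also have "\<dots> \<le> (c + 1) * ln p" using c lnp by (simp add: algebra_simps mult_le_cancel_left1)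
  finally have lnp': "ln (4 * real p / \<alpha>) \<le> (c + 1) * ln p" .
  have "posi_const X (models p t) \<alpha> \<le> sqrt (2 * ln (4 * real p / \<alpha>)) + 2 * d * sqrt (2 * ln (4 * N / \<alpha>))"
    using t card_model_pairs_le[of t p] N1 by (intro posi_const_upper[OF X _ _ rip d \<alpha>]) (auto simp: N_def)
  also have "\<dots> \<le> sqrt (2 * (c + 1) * ln p) + 2 * d * sqrt (2 * (c + 2) * (real s * l s))"
    unfolding mult.assoc using d by (intro add_mono mult_left_mono real_sqrt_le_mono lnp' lnN) auto
  also have "\<dots> = sqrt (2 * (c + 1)) * sqrt (ln p) + 2 * sqrt (2 * (c + 2)) * (d * sqrt s * sqrt (l s))"
    by (simp add: real_sqrt_mult)
  also have "\<dots> \<le> sqrt (2 * (c + 1)) * (d * sqrt s * sqrt (l s)) + 2 * sqrt (2 * (c + 2)) * (d * sqrt s * sqrt (l s))"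
    using dom c d by (intro add_mono mult_left_mono) (auto simp: l_def)
  finally show ?thesis by (simp add: c_def l_def algebra_simps)
qed

text \<open>At \<open>T = sqrt (ln m)\<close> the bound of \<open>std_normal_upper_tail_ge\<close>
  equals \<open>tail_const / m\<close>.\<close>

definition tail_const :: real where "tail_const = exp (- 1) / sqrt (2 * pi)"

lemma tail_const: "0 < tail_const" "tail_const \<le> 1"
proof -
  have "exp (- 1 :: real) \<le> 1" by simp
  also have "1 \<le> sqrt (2 * pi)" using pi_ge_two by simp
  finally show "tail_const \<le> 1" by (simp add: tail_const_def)
qed (simp add: tail_const_def)

text \<open>Each of the roughly \<open>s * m\<close> coordinates exceeds \<open>sqrt (ln m)\<close>
  with probability at least \<open>tail_const / m\<close>, so the expected number of exceedances is
  at least a constant times \<open>s\<close>. The upper bounds on \<open>m\<close> ensure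
  \<open>k * a^2 \<le> 1\<close> and \<open>k \<le> p - 1\<close> for the design.\<close>

lemma posi_const_lower_rate:
  assumes p: "2 \<le> p" and s: "2 \<le> s" "s < p" and d: "0 < d" "d < 1" and \<alpha>: "0 < \<alpha>" "\<alpha> < 1"
    and m: "1 \<le> m" "m \<le> 1 / d\<^sup>2" "real s * m \<le> real p - 1"
    and small: "exp (- (real s * tail_const / 20)) \<le> (1 - \<alpha>) / 4"
  shows "\<exists>X\<in>carrier_mat p p. rip_delta X s \<le> d \<and>
    tail_const / 4 * d * sqrt s * sqrt (ln m) - sqrt (2 * ln (8 / (1 - \<alpha>))) \<le> posi_const X (models p s) \<alpha>"
proof -
  \<comment> \<open>\<open>a\<close> is the largest entry that \<open>spike_rip\<close> allows:
    \<open>s * a^2 = d^2\<close>.\<close>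
  define a k T q where "a = d / sqrt s" and "k = nat \<lfloor>real s * m\<rfloor>" and "T = sqrt (ln m)"
    and "q = measure std_normal {T..}"
  have sm: "1 \<le> real s * m" using s m mult_mono[of 1 "real s" 1 m] by simp
  have k_le: "real k \<le> real s * m" using sm by (simp add: k_def)
  \<comment> \<open>Taking the floor costs at most a factor 2 because
    \<open>s * m \<ge> 1\<close>.\<close>
  have k_ge: "real s * m / 2 \<le> real k" 
  proof -
    have "1 \<le> \<lfloor>real s * m\<rfloor>" using sm by (simp add: le_floor_iff)
    moreover from this have "real k = of_int \<lfloor>real s * m\<rfloor>" by (simp add: k_def)
    ultimately show ?thesis using floor_correct[of "real s * m"] by linarith
  qed
  have kp: "k \<le> p - 1" using k_le m(3) p by (simp add: of_nat_diff flip: of_nat_le_iff)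
  have a2: "a\<^sup>2 = d\<^sup>2 / real s" by (simp add: a_def power_divide)
  have "real k * d\<^sup>2 \<le> real s * (m * d\<^sup>2)"
    using mult_right_mono[OF k_le, of "d\<^sup>2"] by (simp add: mult.assoc)
  also have "\<dots> \<le> real s * 1" using m d by (intro mult_left_mono) (auto simp: field_simps)
  finally have ka: "real k * a\<^sup>2 \<le> 1" using s by (simp add: a2 field_simps)
  define X where "X = spike_design p k a"
  have rip: "rip_delta X s \<le> d"
    unfolding X_def using s d by (intro spike_rip[OF p kp ka]) (auto simp: a2)
  have "tail_const / m = exp (- T\<^sup>2 - 1) / sqrt (2 * pi)"
    using m by (simp add: tail_const_def T_def exp_diff exp_minus field_simps)
  also have "\<dots> \<le> q" unfolding q_def using m by (intro std_normal_upper_tail_ge) (auto simp: T_def)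
  finally have "real s * m / 2 * (tail_const / m) \<le> real k * q"
    using k_ge m tail_const(1) by (intro mult_mono) auto
  then have kq: "real s * tail_const / 2 \<le> real k * q" using m by simp
  have "a * (T * (real s * tail_const / 4)) \<le> a * (T * min (real s - 1) (real k * q / 2))"
  proof (intro mult_left_mono)
    \<comment> \<open>For \<open>s \<ge> 2\<close> the cap \<open>s - 1\<close> on the size of
      \<open>M\<close> still exceeds \<open>s / 4\<close>.\<close>
    have "real s * tail_const / 4 \<le> real s * 1 / 4"
      using tail_const by (intro divide_right_mono mult_left_mono) auto
    also have "\<dots> \<le> real s - 1" using s by simp
    finally show "real s * tail_const / 4 \<le> min (real s - 1) (real k * q / 2)"
      using kq by - (rule min.boundedI; linarith)
  qed (use d m in \<open>auto simp: a_def T_def\<close>)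
  moreover have "a * (T * (real s * tail_const / 4)) = tail_const / 4 * d * sqrt s * sqrt (ln m)"
    using s by (simp add: a_def T_def field_simps)
  moreover have "exp (- (real k * q / 10)) \<le> (1 - \<alpha>) / 4" using kq
    by (intro order_trans[OF _ small]) (unfold exp_le_cancel_iff, linarith)
  then have "a * (T * min (real s - 1) (real k * q / 2)) - sqrt (2 * ln (8 / (1 - \<alpha>)))
      \<le> posi_const X (models p s) \<alpha>"
    unfolding X_def q_def using s d m
    by (intro spike_posi_const_ge[OF p kp ka _ _ rip[unfolded X_def] d(2) \<alpha>]) (auto simp: a_def T_def)
  ultimately have "tail_const / 4 * d * sqrt s * sqrt (ln m) - sqrt (2 * ln (8 / (1 - \<alpha>)))
      \<le> posi_const X (models p s) \<alpha>"
    by linarith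
  then show ?thesis using rip spike_carrier[OF p kp ka] unfolding X_def by blast
qed

text \<open>With \<open>g\<close> the floor, \<open>6 * p / s \<le> g ^ 6\<close> settles the case
  that \<open>g\<close> is the minimum; if \<open>y\<close> is, \<open>ln (6 * p / s)\<close> is at
  most \<open>6 * ln p\<close>, hence at most \<open>6 / r * ln y\<close>. Later \<open>y\<close> is
  \<open>1 / (\<delta> p)^2\<close>.\<close>

lemma ln_rate_compare:
  fixes x y :: real and p s :: nat
  assumes p: "3 \<le> p" and s: "1 \<le> s" "s < p" and f: "2 \<le> \<lfloor>(real p - 1) / real s\<rfloor>"
    and r: "0 < r" and y: "2 \<le> y" "r * ln p \<le> ln y"
  defines "x \<equiv> min y (real_of_int \<lfloor>(real p - 1) / real s\<rfloor>)"
  shows "0 < ln x" "ln x \<le> ln (6 * real p / real s)"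
    "ln (6 * real p / real s) \<le> max 6 (6 / r) * ln x"
proof -
  define g where "g = real_of_int \<lfloor>(real p - 1) / real s\<rfloor>"
  have g: "2 \<le> g" "g \<le> (real p - 1) / real s" "(real p - 1) / real s < g + 1"
    using f floor_correct[of "(real p - 1) / real s"] by (auto simp: g_def)
  have x2: "2 \<le> x" using y g by (simp add: x_def g_def)
  then show lx: "0 < ln x" by simp
  have "x \<le> g" by (simp add: x_def g_def)
  also have "g \<le> real p / real s" using g(2) s by (simp add: field_simps)
  also have "\<dots> \<le> 6 * real p / real s" using s by (simp add: divide_right_mono)
  finally show "ln x \<le> ln (6 * real p / real s)" using x2 by simp
  have lnp: "1 \<le> ln (real p)" using p by (intro one_le_ln) auto
  \<comment> \<open>\<open>p \<le> 2 * (p - 1)\<close> and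
    \<open>(p - 1) / s < g + 1 \<le> 3/2 * g\<close>, the latter by \<open>g \<ge> 2\<close>; the
    resulting factor 18 is below \<open>2 ^ 5 \<le> g ^ 5\<close>.\<close>
  have "real p / real s \<le> 2 * ((real p - 1) / real s)" using p s by (simp add: field_simps)
  also have "\<dots> \<le> 3 * g" using g by linarith
  finally have "6 * real p / real s \<le> 18 * g" by simp
  also have "18 * g \<le> 2 ^ 5 * g" using g by simp
  also have "\<dots> \<le> g ^ 5 * g" using g by (intro mult_right_mono power_mono) auto
  finally have "6 * real p / real s \<le> g ^ 6" by (simp add: power_numeral_reduce mult.commute)
  then have "ln (6 * real p / real s) \<le> ln (g ^ 6)" using p s g by (subst ln_le_cancel_iff) auto
  then have 1: "ln (6 * real p / real s) \<le> 6 * ln g" using g by (simp add: ln_realpow)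
  have "ln (6 * real p / real s) \<le> ln (6 * real p)"
    using p s by (subst ln_le_cancel_iff) (auto simp: field_simps)
  also have "\<dots> = ln 6 + ln (real p)" using p by (simp add: ln_mult)
  also have "\<dots> \<le> 6 * ln (real p)" using ln_le_minus_one[of 6] lnp by simp
  also have "\<dots> = 6 / r * (r * ln (real p))" using r by simp
  also have "\<dots> \<le> 6 / r * ln y" using y r by (intro mult_left_mono) auto
  finally have 2: "ln (6 * real p / real s) \<le> 6 / r * ln y" .
  have "6 * ln x \<le> max 6 (6 / r) * ln x" "6 / r * ln x \<le> max 6 (6 / r) * ln x"
    using lx by (intro mult_right_mono; simp)+
  moreover have "x = y \<or> x = g" by (auto simp: x_def g_def min_def)
  ultimately show "ln (6 * real p / real s) \<le> max 6 (6 / r) * ln x" using 1 2 by auto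
qed

section \<open>Assembly of the rates along the sequences\<close>

theorem corollary4p3:
  fixes \<alpha> :: real and s :: "nat \<Rightarrow> nat" and \<delta> :: "nat \<Rightarrow> real"
  assumes alpha: "0 < \<alpha>" "\<alpha> < 1"
    and s: "\<And>p. 2 \<le> p \<Longrightarrow> 1 \<le> s p \<and> s p < p"
    and delta_pos: "\<And>p. 2 \<le> p \<Longrightarrow> 0 < \<delta> p"
    and delta_lim: "\<delta> \<longlonglongrightarrow> 0"
    and rate: "filterlim (\<lambda>p. \<delta> p * sqrt (real (s p)) *
                 sqrt (1 - ln (real (s p)) / ln (real p) + 1 / ln (real p))) at_top sequentially"
  shows "\<exists>A > 0. \<exists>B > 0.
    (\<forall>\<^sub>F p in sequentially.
       (SUP (t, X) \<in> {(t, X). 1 \<le> t \<and> t \<le> s p \<and> (\<exists>n. X \<in> carrier_mat n p) \<and> rip_delta X t \<le> \<delta> p}.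
          ereal (posi_const X (models p t) \<alpha>)) \<le> ereal (upper_rate s \<delta> B p) \<and>
       (\<exists>n. \<exists>X \<in> carrier_mat n p. rip_delta X (s p) \<le> \<delta> p \<and>
          posi_const X (models p (s p)) \<alpha> \<ge> lower_rate s \<delta> A p)) \<and>
    ((\<exists>r > 0. \<delta> \<in> O(\<lambda>p. real p powr (- r))) \<and>
     (\<forall>\<^sub>F p in sequentially. \<lfloor>(real p - 1) / real (s p)\<rfloor> \<ge> 2) \<longrightarrow>
       (\<exists>c > 0. \<exists>C. \<forall>\<^sub>F p in sequentially.
          c \<le> upper_rate s \<delta> B p / lower_rate s \<delta> A p \<and>
          upper_rate s \<delta> B p / lower_rate s \<delta> A p \<le> C))"
proof -
  note s1 = s[THEN conjunct1] and sp = s[THEN conjunct2]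
  define R where "R p = \<delta> p * sqrt (real (s p)) *
                 sqrt (1 - ln (real (s p)) / ln (real p) + 1 / ln (real p))" for p
  have R: "filterlim R at_top sequentially" using rate by (simp add: R_def[abs_def])
  have p3: "\<forall>\<^sub>F p in sequentially. 3 \<le> p" by (rule eventually_ge_at_top)
  have delta_small: "\<forall>\<^sub>F p in sequentially. \<delta> p \<le> 1 / 2"
    using order_tendstoD(2)[OF delta_lim, of "1 / 2"] by (auto elim: eventually_mono)
  \<comment> \<open>The last root in the rate assumption is at most 2 once
    \<open>ln p \<ge> 1\<close>, so the divergence comes from
    \<open>\<delta> p * sqrt (s p)\<close>.\<close>
  have delta_sqrt: "filterlim (\<lambda>p. \<delta> p * sqrt (real (s p))) at_top sequentially"
  proof (rule filterlim_at_top_mono)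
    show "filterlim (\<lambda>p. 1 / 2 * R p) at_top sequentially"
      by (rule filterlim_tendsto_pos_mult_at_top[OF tendsto_const _ R]) simp
    show "\<forall>\<^sub>F p in sequentially. 1 / 2 * R p \<le> \<delta> p * sqrt (real (s p))"
      using p3
    proof eventually_elim
      case (elim p)
      have lnp: "1 \<le> ln (real p)" using elim by (intro one_le_ln) auto
      have "0 \<le> ln (real (s p))" using s1[of p] elim by simp
      then have "1 - ln (real (s p)) / ln (real p) + 1 / ln (real p) \<le> 2\<^sup>2"
        using lnp by (simp add: field_simps)
      then have "sqrt (1 - ln (real (s p)) / ln (real p) + 1 / ln (real p)) \<le> 2"
        by (intro real_le_lsqrt) auto
      then have "R p \<le> \<delta> p * sqrt (real (s p)) * 2"
        unfolding R_def using delta_pos[of p] elim by (intro mult_left_mono) auto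
      then show ?case by simp
    qed
  qed
  \<comment> \<open>Since eventually \<open>\<delta> p \<le> 1 / 2\<close>, divergence of
    \<open>\<delta> p * sqrt (s p)\<close> forces \<open>s p\<close> to diverge.\<close>
  have s_top: "filterlim (\<lambda>p. real (s p)) at_top sequentially"
  proof (rule filterlim_at_top_mono[OF delta_sqrt])
    show "\<forall>\<^sub>F p in sequentially. \<delta> p * sqrt (real (s p)) \<le> real (s p)"
      using p3 delta_small
    proof eventually_elim
      case (elim p)
      have "1 \<le> real (s p)" using s1[of p] elim by simp
      then have "sqrt (real (s p)) \<le> real (s p)" by (auto intro!: real_le_lsqrt self_le_power)
      moreover have "\<delta> p * sqrt (real (s p)) \<le> 1 * sqrt (real (s p))"
        using elim by (intro mult_right_mono) auto
      ultimately show ?case by simp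
    qed
  qed
  \<comment> \<open>Half of the factor \<open>tail_const / 4\<close> in
    \<open>posi_const_lower_rate\<close>; the other half absorbs the additive constant
    \<open>C\<close>.\<close>
  define A where "A = tail_const / 8"
  define B where "B = sqrt (2 * (ln (4 / \<alpha>) + 1)) + 2 * sqrt (2 * (ln (4 / \<alpha>) + 2))"
  define C where "C = sqrt (2 * ln (8 / (1 - \<alpha>)))"
  have A: "A > 0" using tail_const by (simp add: A_def)
  have "ln (4 / \<alpha>) \<ge> 0" using alpha by simp
  then have B: "B > 0" unfolding B_def by (intro add_pos_nonneg) auto
  have upper: "\<forall>\<^sub>F p in sequentially.
       (SUP (t, X) \<in> {(t, X). 1 \<le> t \<and> t \<le> s p \<and> (\<exists>n. X \<in> carrier_mat n p) \<and> rip_delta X t \<le> \<delta> p}.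
          ereal (posi_const X (models p t) \<alpha>)) \<le> ereal (upper_rate s \<delta> B p)"
    using p3 delta_small R[unfolded filterlim_at_top, rule_format, of 1]
  proof eventually_elim
    case (elim p)
    have lnp: "1 \<le> ln (real p)" using elim by (intro one_le_ln) auto
    have sp: "1 \<le> s p" "s p < p" using s[of p] elim by auto
    \<comment> \<open>In this form, \<open>R p \<ge> 1\<close> multiplied by
      \<open>sqrt (ln p)\<close> gives the hypothesis \<open>dom\<close> of
      \<open>posi_const_upper_rate\<close>, because \<open>1 \<le> ln 6\<close>.\<close>
    have "1 - ln (real (s p)) / ln (real p) + 1 / ln (real p) = (1 + ln (real p / real (s p))) / ln (real p)"
      using lnp sp by (simp add: ln_div field_simps)
    then have "sqrt (ln (real p)) \<le> \<delta> p * sqrt (real (s p)) * sqrt (1 + ln (real p / real (s p)))"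
      using elim(3) lnp by (simp add: R_def real_sqrt_divide field_simps)
    also have "\<dots> \<le> \<delta> p * sqrt (real (s p)) * sqrt (ln (6 * real p / real (s p)))"
    proof (intro mult_left_mono real_sqrt_le_mono)
      have "ln (6 * (real p / real (s p))) = ln 6 + ln (real p / real (s p))"
        using sp by (subst ln_mult) auto
      then show "1 + ln (real p / real (s p)) \<le> ln (6 * real p / real (s p))"
        using one_le_ln[of 6] by simp
    qed (use delta_pos[of p] elim in auto)
    finally have dom: "sqrt (ln (real p)) \<le> \<delta> p * sqrt (real (s p)) * sqrt (ln (6 * real p / real (s p)))" .
    show ?case
    proof (rule SUP_least, clarify)
      fix t X n assume "1 \<le> t" "t \<le> s p" "X \<in> carrier_mat n p" "rip_delta X t \<le> \<delta> p"
      then show "ereal (posi_const X (models p t) \<alpha>) \<le> ereal (upper_rate s \<delta> B p)"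
        using posi_const_upper_rate[of X n p t "s p" "\<delta> p" \<alpha>] sp dom elim delta_pos[of p] alpha
        by (simp add: upper_rate_def B_def)
    qed
  qed
  have lower: "\<forall>\<^sub>F p in sequentially. \<exists>n. \<exists>X \<in> carrier_mat n p. rip_delta X (s p) \<le> \<delta> p \<and>
          posi_const X (models p (s p)) \<alpha> \<ge> lower_rate s \<delta> A p"
    \<comment> \<open>The thresholds let the main term absorb \<open>C\<close> as soon as
      \<open>m \<ge> 2\<close>, and provide \<open>s p \<ge> 2\<close> and the hypothesis
      \<open>small\<close> of \<open>posi_const_lower_rate\<close>.\<close>
    using p3 delta_small delta_sqrt[unfolded filterlim_at_top, rule_format, of "C / (A * sqrt (ln 2))"]
      s_top[unfolded filterlim_at_top, rule_format, of "max 2 (20 / tail_const * ln (4 / (1 - \<alpha>)))"]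
  proof eventually_elim
    case (elim p)
    have sp: "2 \<le> s p" "s p < p" using s[of p] elim by auto
    have d: "0 < \<delta> p" "\<delta> p < 1" using delta_pos[of p] elim by auto
    define g where "g = \<lfloor>(real p - 1) / real (s p)\<rfloor>"
    define m where "m = min (1 / (\<delta> p)\<^sup>2) (real_of_int g)"
    have g1: "1 \<le> g" using sp by (simp add: g_def le_floor_iff)
    have gp: "real (s p) * real_of_int g \<le> real p - 1"
    proof -
      have "real_of_int g \<le> (real p - 1) / real (s p)" unfolding g_def by (rule of_int_floor_le)
      then show ?thesis using sp by (simp add: field_simps)
    qed
    have "(\<delta> p)\<^sup>2 \<le> (1 / 2)\<^sup>2" using d elim by (intro power_mono) auto
    then have d2: "2 \<le> 1 / (\<delta> p)\<^sup>2" using d by (simp add: field_simps power2_eq_square)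
    show ?case
    proof (cases "g = 1")
      \<comment> \<open>Here the minimum is 1, so its logarithm and the claimed bound are 0; the
        identity matrix \<open>spike_design p 0 0\<close> serves as the design.\<close>
      case True
      have "lower_rate s \<delta> A p = 0" using d2 True by (simp add: lower_rate_def g_def[symmetric] min_def)
      moreover have "spike_design p 0 0 \<in> carrier_mat p p" "rip_delta (spike_design p 0 0) (s p) \<le> \<delta> p"
        using sp d by (auto intro!: spike_carrier spike_rip)
      moreover have "0 \<le> posi_const (spike_design p 0 0) (models p (s p)) \<alpha>"
        using sp alpha by (intro posi_const_nonneg[of _ p] calculation) auto
      ultimately show ?thesis by auto
    next
      case False
      then have m2: "2 \<le> m" using g1 d2 by (simp add: m_def)
      have "real (s p) * m \<le> real (s p) * real_of_int g" by (intro mult_left_mono) (auto simp: m_def)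
      then have sm: "real (s p) * m \<le> real p - 1" using gp by simp
      have "ln (4 / (1 - \<alpha>)) \<le> real (s p) * tail_const / 20"
        using elim(4) tail_const by (simp add: field_simps)
      then have "exp (- (real (s p) * tail_const / 20)) \<le> exp (- ln (4 / (1 - \<alpha>)))" by simp
      also have "\<dots> = (1 - \<alpha>) / 4" using alpha by (simp add: exp_minus)
      finally have small: "exp (- (real (s p) * tail_const / 20)) \<le> (1 - \<alpha>) / 4" .
      obtain X where X: "X \<in> carrier_mat p p" "rip_delta X (s p) \<le> \<delta> p"
        and ge: "tail_const / 4 * \<delta> p * sqrt (s p) * sqrt (ln m) - C \<le> posi_const X (models p (s p)) \<alpha>"
      proof -
        have "2 \<le> p" "1 \<le> m" "m \<le> 1 / (\<delta> p)\<^sup>2" using elim(1) m2 by (simp_all add: m_def)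
        from posi_const_lower_rate[OF this(1) sp d alpha this(2,3) sm small] show ?thesis
          using that unfolding C_def by blast
      qed
      have "C = A * (C / (A * sqrt (ln 2))) * sqrt (ln 2)" using A by simp
      also have "\<dots> \<le> A * (\<delta> p * sqrt (s p)) * sqrt (ln m)"
        using elim(3) A d m2 alpha by (intro mult_mono mult_left_mono) (auto simp: C_def)
      finally have "A * \<delta> p * sqrt (s p) * sqrt (ln m) \<le> tail_const / 4 * \<delta> p * sqrt (s p) * sqrt (ln m) - C"
        by (simp add: A_def mult_ac)
      then have "lower_rate s \<delta> A p \<le> posi_const X (models p (s p)) \<alpha>"
        using ge by (simp add: lower_rate_def m_def g_def)
      then show ?thesis using X by blast
    qed
  qed
  have ratio: "\<exists>c > 0. \<exists>C. \<forall>\<^sub>F p in sequentially.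
          c \<le> upper_rate s \<delta> B p / lower_rate s \<delta> A p \<and>
          upper_rate s \<delta> B p / lower_rate s \<delta> A p \<le> C"
    if r: "r > 0" "\<delta> \<in> O(\<lambda>p. real p powr (- r))"
      and fl: "\<forall>\<^sub>F p in sequentially. \<lfloor>(real p - 1) / real (s p)\<rfloor> \<ge> 2" for r
  proof -
    obtain K where K: "K > 0" "\<forall>\<^sub>F p in sequentially. norm (\<delta> p) \<le> K * norm (real p powr (- r))"
      using r(2) by (rule landau_o.bigE)
    \<comment> \<open>Half of the decay removes the constant \<open>K\<close>: once
      \<open>K^2 \<le> p powr r\<close>, the square of \<open>\<delta> p\<close> is at most
      \<open>p powr (- r)\<close>.\<close>
    have "filterlim (\<lambda>p. real p powr r) at_top sequentially"
      using r(1) by (intro filterlim_compose[OF real_powr_at_top filterlim_real_sequentially])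
    then have Kr: "\<forall>\<^sub>F p in sequentially. K\<^sup>2 \<le> real p powr r"
      by (simp add: filterlim_at_top)
    define D where "D = max 6 (6 / r)"
    have "\<forall>\<^sub>F p in sequentially. B / A \<le> upper_rate s \<delta> B p / lower_rate s \<delta> A p \<and>
          upper_rate s \<delta> B p / lower_rate s \<delta> A p \<le> B / A * sqrt D"
      using p3 delta_small K(2) Kr fl
    proof eventually_elim
      case (elim p)
      have sp: "1 \<le> s p" "s p < p" using s[of p] elim by auto
      have d: "0 < \<delta> p" using delta_pos[of p] elim by auto
      have "(\<delta> p)\<^sup>2 \<le> (1 / 2)\<^sup>2" using d elim by (intro power_mono) auto
      then have d2: "2 \<le> 1 / (\<delta> p)\<^sup>2" using d by (simp add: field_simps power2_eq_square)
      have "(\<delta> p)\<^sup>2 \<le> (K * real p powr (- r))\<^sup>2" using d elim(3) by (intro power_mono) auto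
      also have "\<dots> = K\<^sup>2 * (real p powr (- r) * real p powr (- r))" by (simp add: power2_eq_square)
      also have "\<dots> \<le> real p powr r * (real p powr (- r) * real p powr (- r))"
        using elim(4) by (intro mult_right_mono) auto
      also have "\<dots> = real p powr (- r)" using elim(1) by (simp add: powr_add[symmetric])
      finally have "(\<delta> p)\<^sup>2 * real p powr r \<le> 1"
        using elim(1) by (simp add: powr_minus field_simps)
      then have "real p powr r \<le> 1 / (\<delta> p)\<^sup>2" using d by (simp add: field_simps)
      then have "ln (real p powr r) \<le> ln (1 / (\<delta> p)\<^sup>2)"
        using elim(1) d by (subst ln_le_cancel_iff) auto
      then have ln: "r * ln (real p) \<le> ln (1 / (\<delta> p)\<^sup>2)" using elim(1) by (simp add: ln_powr)
      define L H where "L = ln (min (1 / (\<delta> p)\<^sup>2) (real_of_int \<lfloor>(real p - 1) / real (s p)\<rfloor>))"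
        and "H = ln (6 * real p / real (s p))"
      have LH: "0 < L" "L \<le> H" "H \<le> D * L"
        unfolding L_def H_def D_def using ln_rate_compare[OF elim(1) sp elim(5) r(1) d2 ln] by auto
      \<comment> \<open>Everything but the constants and the logarithms cancels, and
        \<open>H / L\<close> lies between 1 and \<open>D\<close>.\<close>
      have "upper_rate s \<delta> B p / lower_rate s \<delta> A p = B / A * sqrt (H / L)"
        using d sp by (simp add: upper_rate_def lower_rate_def L_def H_def real_sqrt_divide)
      moreover have "1 \<le> sqrt (H / L)" "sqrt (H / L) \<le> sqrt D"
        using LH by (auto simp: field_simps)
      moreover have "0 < B / A" using A B by simp
      ultimately show ?case
        using mult_left_mono[of 1 "sqrt (H / L)" "B / A"] mult_left_mono[of "sqrt (H / L)" "sqrt D" "B / A"]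
        by simp
    qed
    moreover have "B / A > 0" using A B by simp
    ultimately show ?thesis by blast
  qed
  show ?thesis
    by (rule exI[of _ A], rule conjI[OF A], rule exI[of _ B], rule conjI[OF B],
        rule conjI[OF eventually_conj[OF upper lower]], intro impI, elim conjE exE)
       (rule ratio)
qed

end
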